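(* Let $d\ge2$, $\lambda>0$, and let $\xi,\epsilon\in(0,1)$ be two constants. Let $t>0$ be a sufficiently large integer. Suppose that the cube $Q_L$, for $L=t$, is tessellated into cells of side length $\ell$, where $\ell^d\ge C\log^3 t$ for some sufficiently large constant $C$. For $i=0,1,\dots$ let $$A_i=\{\text{at time } i \text{ all cells contain at least } (1-\xi)\lambda\ell^d \text{ nodes of } \Pi_i\}.$$ Then there exists a positive constant $c$ (not depending on $t$) such that $$\mathbf{P}\left[\sum_{i=0}^{t-1}\mathbf{1}(A_i)\ge(1-\epsilon)t\right]\ge 1-\exp\left(-c\,\frac{\lambda t}{\log^{3+6/d}t}\right).$$
   Context: $\Pi_0=\{X_i\}_i$ is a Poisson point process on $\mathbb{R}^d$ of intensity $\lambda$; each node $X_i$ moves as $X_i+\zeta_i(s)$, $s\ge 0$, where the $\zeta_i$ are independent standard $d$-dimensional Brownian motions started at $0$, independent of $\Pi_0$, and $\Pi_s=\{X_i+\zeta_i(s)\}_i$ is the point process of node positions at time $s$. $Q_L$ denotes the cube in $\mathbb{R}^d$ with side length $L$, centered at the origin, with sides parallel to the axes; "cells" are the subcubes of side length $\ell$ of its tessellation. *)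

theory Defs
  imports "HOL-Probability.Probability"
begin

text \<open>
  A point configuration is given by an enumeration, so points are counted with multiplicity.
  The count takes values in \<^typ>\<open>ennreal\<close>, so that an infinite number of points in a set
  counts as infinity (whereas \<^const>\<open>card\<close> would give 0).
\<close>

definition num_points :: "(nat \<Rightarrow> 'a) \<Rightarrow> 'a set \<Rightarrow> ennreal" where
  "num_points x B = emeasure (count_space UNIV) {i. x i \<in> B}"

text \<open>
  For positive intensity the process on the whole space has almost surely infinitely many points,
  so indexing by \<^typ>\<open>nat\<close> loses no generality.
  The law of the counts is spelled out instead of using \<^const>\<open>poisson_pmf\<close>, which is only
  meaningful for a strictly positive rate; here the rate is 0 for null sets.
\<close>

definition (in prob_space) poisson_point_process ::
    "real \<Rightarrow> (nat \<Rightarrow> 'a \<Rightarrow> 'b::euclidean_space) \<Rightarrow> bool" where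
  "poisson_point_process lam X \<longleftrightarrow>
     (\<forall>i. random_variable borel (X i)) \<and>
     (\<forall>B\<in>sets borel. emeasure lborel B < \<infinity> \<longrightarrow>
        (\<forall>k::nat. \<P>(\<omega> in M. num_points (\<lambda>i. X i \<omega>) B = of_nat k) =
           exp (- (lam * measure lborel B)) * (lam * measure lborel B) ^ k / fact k)) \<and>
     (\<forall>B::nat \<Rightarrow> 'b set. range B \<subseteq> sets borel \<longrightarrow> disjoint_family B \<longrightarrow>
        indep_vars (\<lambda>_. borel) (\<lambda>j \<omega>. num_points (\<lambda>i. X i \<omega>) (B j)) UNIV)"

text \<open>Standard Brownian motion; only times \<open>s \<ge> 0\<close> are constrained.\<close>

definition (in prob_space) std_brownian_motion ::
    "(real \<Rightarrow> 'a \<Rightarrow> real ^ 'd) \<Rightarrow> bool" where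
  "std_brownian_motion W \<longleftrightarrow>
     (\<forall>s\<ge>0. random_variable borel (W s)) \<and>
     (AE \<omega> in M. W 0 \<omega> = 0) \<and>
     (AE \<omega> in M. continuous_on {0..} (\<lambda>s. W s \<omega>)) \<and>
     (\<forall>s\<ge>0. \<forall>t>s. distributed M lborel (\<lambda>\<omega>. W t \<omega> - W s \<omega>)
        (\<lambda>x. ennreal (\<Prod>k\<in>UNIV. normal_density 0 (sqrt (t - s)) (x $ k)))) \<and>
     (\<forall>\<tau>::nat \<Rightarrow> real. \<tau> 0 \<ge> 0 \<longrightarrow> mono \<tau> \<longrightarrow>
        indep_vars (\<lambda>_. borel) (\<lambda>j \<omega>. W (\<tau> (Suc j)) \<omega> - W (\<tau> j) \<omega>) UNIV)"

abbreviation trajectory_space :: "(real \<Rightarrow> real ^ 'd) measure" where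
  "trajectory_space \<equiv> Pi\<^sub>M {0..} (\<lambda>_. borel)"

definition trajectory :: "(real \<Rightarrow> 'a \<Rightarrow> real ^ 'd) \<Rightarrow> 'a \<Rightarrow> real \<Rightarrow> real ^ 'd" where
  "trajectory W \<omega> = (\<lambda>s\<in>{0..}. W s \<omega>)"

text \<open>
  The motions are independent of the enumerated initial positions, i.e. the labels of the points
  may not depend on the motions. This is expressed by independence of the generated
  \<open>\<sigma>\<close>-algebras, because \<^const>\<open>prob_space.indep_var\<close> requires both random elements
  to have values in the same type.
\<close>

locale mobile_nodes = prob_space M
  for M :: "'a measure" +
  fixes lam :: real
    and X :: "nat \<Rightarrow> 'a \<Rightarrow> real ^ 'd"
    and \<zeta> :: "nat \<Rightarrow> real \<Rightarrow> 'a \<Rightarrow> real ^ 'd"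
  assumes poisson: "poisson_point_process lam X"
    and brownian: "\<And>i. std_brownian_motion (\<zeta> i)"
    and indep_motions: "indep_vars (\<lambda>_. trajectory_space) (\<lambda>i. trajectory (\<zeta> i)) UNIV"
    and motions_indep_positions:
      "indep_set
         (sets (vimage_algebra (space M) (\<lambda>\<omega> i. X i \<omega>) (Pi\<^sub>M UNIV (\<lambda>_. borel))))
         (sets (vimage_algebra (space M) (\<lambda>\<omega> i. trajectory (\<zeta> i) \<omega>)
            (Pi\<^sub>M UNIV (\<lambda>_. trajectory_space))))"

definition node_pos ::
    "(nat \<Rightarrow> 'a \<Rightarrow> real ^ 'd) \<Rightarrow> (nat \<Rightarrow> real \<Rightarrow> 'a \<Rightarrow> real ^ 'd) \<Rightarrow> real \<Rightarrow> 'a \<Rightarrow> nat \<Rightarrow> real ^ 'd" where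
  "node_pos X \<zeta> s \<omega> i = X i \<omega> + \<zeta> i s \<omega>"

text \<open>
  \<open>tessellates l L\<close>: the cube of side length \<open>L\<close> is tiled by cubes of side length \<open>l\<close>.
  The cells are taken half-open, so that they partition the (half-open) cube centred at the
  origin.
\<close>

definition tessellates :: "real \<Rightarrow> real \<Rightarrow> bool" where
  "tessellates l L \<longleftrightarrow> l > 0 \<and> (\<exists>n::nat. n > 0 \<and> L = real n * l)"

definition cell :: "real \<Rightarrow> real \<Rightarrow> ('d \<Rightarrow> nat) \<Rightarrow> (real ^ 'd) set" where
  "cell L l k = {x. \<forall>j. - L / 2 + real (k j) * l \<le> x $ j \<and> x $ j < - L / 2 + (real (k j) + 1) * l}"

definition cells :: "real \<Rightarrow> real \<Rightarrow> (real ^ 'd) set set" where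
  "cells L l = {cell L l k | k. \<forall>j. (real (k j) + 1) * l \<le> L}"

definition dense_event ::
    "'a measure \<Rightarrow> real \<Rightarrow> (nat \<Rightarrow> 'a \<Rightarrow> real ^ 'd) \<Rightarrow> (nat \<Rightarrow> real \<Rightarrow> 'a \<Rightarrow> real ^ 'd) \<Rightarrow>
     real \<Rightarrow> real \<Rightarrow> real \<Rightarrow> nat \<Rightarrow> 'a set" where
  "dense_event M lam X \<zeta> \<xi> L l i =
     {\<omega> \<in> space M. \<forall>B\<in>cells L l.
        num_points (node_pos X \<zeta> (real i) \<omega>) B \<ge> ennreal ((1 - \<xi>) * lam * l ^ CARD('d))}"

end

theory Submission
  imports Defs
begin

text \<open>
  Put \<open>g \<approx> ln\<^sup>2 t\<close>. If more than \<open>\<epsilon> t\<close> of the times are bad, then some residue class modulo \<open>g\<close>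
  contains \<open>m = \<lceil>\<epsilon> t / g\<rceil>\<close> bad times, each with an underpopulated cell. There are at most
  \<open>(t \<cdot> t\<^sup>d)\<^sup>m\<close> choices of \<open>m\<close> pairs of a time and a cell, so a union bound over these choices suffices
  once a single choice has probability at most \<open>exp (- m (d + 2) ln t)\<close>.

  For a fixed choice, let \<open>V\<close> be the number of the chosen pairs that a path visits. The exponential
  Chebyshev inequality and the Laplace functional of the Poisson process of paths reduce the
  estimate to \<open>exp (- \<theta> V) \<le> 1 - \<theta> V + \<theta>\<^sup>2 V\<^sup>2 / 2\<close> integrated over all starting points. A path in a cell
  of side \<open>l\<close> is in a prescribed cell after time \<open>s\<close> with probability at most
  \<open>min 1 ((l / sqrt (2 \<pi> s))\<^sup>d) \<le> l\<^sup>2 / (2 \<pi> s)\<close>, and summing over multiples \<open>s\<close> of \<open>g\<close> gives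
  \<open>\<integral> E V\<^sup>2 \<le> R \<integral> E V\<close> with \<open>R = 1 + l\<^sup>2 (1 + ln t) / g\<close>. The choice \<open>\<theta> = \<xi> / R\<close> yields the bound
  \<open>exp (- m \<lambda> l\<^sup>d \<xi>\<^sup>2 / (2 R))\<close>, which is small enough because \<open>l\<^sup>d \<ge> ln\<^sup>3 t\<close> and \<open>d \<ge> 2\<close>.
\<close>

subsection \<open>The law of the node paths\<close>

text \<open>Turns independence of two generated \<sigma>-algebras into a product of laws, so that
  Fubini applies to positions and motions. Rectangles determine a product measure, and on them the
  claim is the factorisation given by \<open>indep_setD\<close>.\<close>

lemma (in prob_space) distr_pair_eq_pair_measure_of_indep_set:
  assumes f [measurable]: "f \<in> M \<rightarrow>\<^sub>M S" and g [measurable]: "g \<in> M \<rightarrow>\<^sub>M T"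
    and indep: "indep_set (sets (vimage_algebra (space M) f S)) (sets (vimage_algebra (space M) g T))"
  shows "distr M (S \<Otimes>\<^sub>M T) (\<lambda>\<omega>. (f \<omega>, g \<omega>)) = distr M S f \<Otimes>\<^sub>M distr M T g"
proof (rule sym, rule pair_measure_eqI)
  interpret S: prob_space "distr M S f" by (rule prob_space_distr) fact
  interpret T: prob_space "distr M T g" by (rule prob_space_distr) fact
  show "sigma_finite_measure (distr M S f)" "sigma_finite_measure (distr M T g)"
    by unfold_locales
  show "sets (distr M S f \<Otimes>\<^sub>M distr M T g) = sets (distr M (S \<Otimes>\<^sub>M T) (\<lambda>\<omega>. (f \<omega>, g \<omega>)))"
    by simp
next
  fix A B assume "A \<in> sets (distr M S f)" "B \<in> sets (distr M T g)"
  then have A [measurable]: "A \<in> sets S" and B [measurable]: "B \<in> sets T" by auto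
  have eq: "(\<lambda>\<omega>. (f \<omega>, g \<omega>)) -` (A \<times> B) \<inter> space M
      = (f -` A \<inter> space M) \<inter> (g -` B \<inter> space M)" by auto
  have "prob ((f -` A \<inter> space M) \<inter> (g -` B \<inter> space M))
      = prob (f -` A \<inter> space M) * prob (g -` B \<inter> space M)"
    by (rule indep_setD[OF indep]) (auto intro: in_vimage_algebra A B)
  then show "emeasure (distr M S f) A * emeasure (distr M T g) B
      = emeasure (distr M (S \<Otimes>\<^sub>M T) (\<lambda>\<omega>. (f \<omega>, g \<omega>))) (A \<times> B)"
    by (simp add: emeasure_distr eq emeasure_eq_measure ennreal_mult)
qed

context mobile_nodes
begin

lemma X_measurable [measurable]: "X i \<in> borel_measurable M"
  using poisson by (simp add: poisson_point_process_def)

lemma trajectory_measurable [measurable]: "trajectory (\<zeta> i) \<in> M \<rightarrow>\<^sub>M trajectory_space"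
  using indep_motions by (auto simp: indep_vars_def)

lemma zeta_measurable [measurable]: "s \<ge> 0 \<Longrightarrow> \<zeta> i s \<in> borel_measurable M"
  using brownian[of i] by (simp add: std_brownian_motion_def)

text \<open>Integrates out the motions while the starting points are frozen: positions and motions
  are independent, so Fubini applies, and the motions are independent of each other, so the inner
  integral factorises. This reduces a functional of the paths to one of the starting points
  alone.\<close>

lemma nn_integral_prod_paths_le:
  fixes G :: "(real ^ 'd) \<times> (real \<Rightarrow> real ^ 'd) \<Rightarrow> ennreal"
  assumes G [measurable]: "G \<in> borel_measurable (borel \<Otimes>\<^sub>M trajectory_space)"
    and h [measurable]: "h \<in> borel_measurable borel"
    and le: "\<And>i x. (\<integral>\<^sup>+\<omega>. G (x, trajectory (\<zeta> i) \<omega>) \<partial>M) \<le> h x"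
  shows "(\<integral>\<^sup>+\<omega>. (\<Prod>i<n. G (X i \<omega>, trajectory (\<zeta> i) \<omega>)) \<partial>M) \<le> (\<integral>\<^sup>+\<omega>. (\<Prod>i<n::nat. h (X i \<omega>)) \<partial>M)"
proof -
  let ?S = "Pi\<^sub>M UNIV (\<lambda>_::nat. borel :: (real^'d) measure)"
  let ?T = "Pi\<^sub>M UNIV (\<lambda>_::nat. trajectory_space :: (real \<Rightarrow> real^'d) measure)"
  let ?f = "\<lambda>\<omega> i. X i \<omega>" and ?g = "\<lambda>\<omega> i. trajectory (\<zeta> i) \<omega>"
  have f [measurable]: "?f \<in> M \<rightarrow>\<^sub>M ?S"
    by (rule measurable_PiM_single') auto
  have g [measurable]: "?g \<in> M \<rightarrow>\<^sub>M ?T"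
    by (rule measurable_PiM_single') (auto simp: space_PiM PiE_def trajectory_def)
  interpret T: prob_space "distr M ?T ?g" by (rule prob_space_distr) fact
  have "(\<integral>\<^sup>+\<omega>. (\<Prod>i<n. G (X i \<omega>, trajectory (\<zeta> i) \<omega>)) \<partial>M)
      = (\<integral>\<^sup>+z. (\<Prod>i<n. G (fst z i, snd z i)) \<partial>distr M (?S \<Otimes>\<^sub>M ?T) (\<lambda>\<omega>. (?f \<omega>, ?g \<omega>)))"
    by (subst nn_integral_distr) (auto intro!: borel_measurable_prod)
  also have "\<dots> = (\<integral>\<^sup>+x. \<integral>\<^sup>+y. (\<Prod>i<n. G (x i, y i)) \<partial>distr M ?T ?g \<partial>distr M ?S ?f)"
    by (subst distr_pair_eq_pair_measure_of_indep_set[OF f g motions_indep_positions],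
        subst T.nn_integral_fst[symmetric]) (auto intro!: borel_measurable_prod)
  also have "\<dots> \<le> (\<integral>\<^sup>+x. (\<Prod>i<n. h (x i)) \<partial>distr M ?S ?f)"
  proof (rule nn_integral_mono)
    fix x :: "nat \<Rightarrow> real^'d"
    have "(\<integral>\<^sup>+y. (\<Prod>i<n. G (x i, y i)) \<partial>distr M ?T ?g)
        = (\<integral>\<^sup>+\<omega>. (\<Prod>i<n. G (x i, trajectory (\<zeta> i) \<omega>)) \<partial>M)"
      by (subst nn_integral_distr) (auto intro!: borel_measurable_prod)
    also have "\<dots> = (\<Prod>i<n. \<integral>\<^sup>+\<omega>. G (x i, trajectory (\<zeta> i) \<omega>) \<partial>M)"
    proof (rule indep_vars_nn_integral)
      show "indep_vars (\<lambda>_. borel) (\<lambda>i \<omega>. G (x i, trajectory (\<zeta> i) \<omega>)) {..<n}"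
        by (rule indep_vars_compose2[OF indep_vars_subset[OF indep_motions]]) auto
    qed auto
    also have "\<dots> \<le> (\<Prod>i<n. h (x i))"
      by (intro prod_mono_ennreal le)
    finally show "(\<integral>\<^sup>+y. (\<Prod>i<n. G (x i, y i)) \<partial>distr M ?T ?g) \<le> (\<Prod>i<n. h (x i))" .
  qed
  also have "\<dots> = (\<integral>\<^sup>+\<omega>. (\<Prod>i<n. h (X i \<omega>)) \<partial>M)"
    by (subst nn_integral_distr) (auto intro!: borel_measurable_prod)
  finally show ?thesis .
qed

end

subsection \<open>Laplace functional of a Poisson process\<close>

text \<open>The value at \<open>\<infinity>\<close> is 0, even for \<open>c = 0\<close>; this does no harm since the counts are almost surely finite.\<close>

definition thinning_gf :: "real \<Rightarrow> ennreal \<Rightarrow> ennreal" where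
  "thinning_gf c y = (\<Sum>k. ennreal ((1 - c) ^ k) * indicator {of_nat k} y)"

lemma thinning_gf_measurable [measurable]: "thinning_gf c \<in> borel_measurable borel"
  unfolding thinning_gf_def by measurable

lemma thinning_gf_of_nat: "thinning_gf c (of_nat k) = ennreal ((1 - c) ^ k)"
proof -
  have "thinning_gf c (of_nat k) = (\<Sum>j\<in>{k}. ennreal ((1 - c) ^ j) * indicator {of_nat j} (of_nat k :: ennreal))"
    unfolding thinning_gf_def by (rule suminf_finite) (auto simp: indicator_def)
  then show ?thesis by simp
qed

text \<open>Finitely many points lie in \<open>D\<close>, so all but \<open>k\<close> factors equal
  1 and the partial products are eventually constant.\<close>

lemma LIMSEQ_prod_thinning:
  fixes x :: "nat \<Rightarrow> 'b"
  assumes "num_points x D = of_nat k" "c \<le> 1"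
  shows "(\<lambda>n. \<Prod>i<n. ennreal (1 - c * indicator D (x i))) \<longlonglongrightarrow> thinning_gf c (num_points x D)"
proof -
  have fin: "finite {i. x i \<in> D}" using assms(1)
    by (rule_tac ccontr) (simp add: num_points_def emeasure_count_space_infinite)
  then have k: "card {i. x i \<in> D} = k" using assms(1)
    by (simp add: num_points_def emeasure_count_space_finite)
  \<comment> \<open>\<open>insert 0\<close> keeps \<open>Max\<close> meaningful when no point lies
    in \<open>D\<close>.\<close>
  have "(\<Prod>i<n. ennreal (1 - c * indicator D (x i))) = ennreal ((1 - c) ^ k)"
    if n: "n > Max (insert 0 {i. x i \<in> D})" for n
  proof -
    have "{i. x i \<in> D} \<subseteq> {..<n}" using fin n by auto
    then have "(\<Prod>i<n. ennreal (1 - c * indicator D (x i)))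
        = (\<Prod>i\<in>{i. x i \<in> D}. ennreal (1 - c * indicator D (x i)))"
      by (intro prod.mono_neutral_right) auto
    also have "\<dots> = (\<Prod>i\<in>{i. x i \<in> D}. ennreal (1 - c))"
      by (intro prod.cong) auto
    also have "\<dots> = ennreal ((1 - c) ^ k)" using assms(2) by (simp add: k ennreal_power)
    finally show ?thesis .
  qed
  then have "eventually (\<lambda>n. (\<Prod>i<n. ennreal (1 - c * indicator D (x i))) = ennreal ((1 - c) ^ k)) sequentially"
    by (rule eventually_mono[OF eventually_gt_at_top])
  then show ?thesis unfolding assms(1) thinning_gf_of_nat by (rule tendsto_eventually)
qed

context prob_space
begin

lemma num_points_measurable_poisson:
  assumes "poisson_point_process lam X" and D: "D \<in> sets borel"
  shows "(\<lambda>\<omega>. num_points (\<lambda>i. X i \<omega>) D) \<in> borel_measurable M"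
proof -
  \<comment> \<open>Measurability of a count is contained in the \<open>indep_vars\<close> clause,
    which speaks of disjoint sequences; \<open>D\<close> is therefore padded with empty
    sets.\<close>
  have "range (\<lambda>j::nat. if j = 0 then D else {}) \<subseteq> sets borel" using D by auto
  moreover have "disjoint_family (\<lambda>j::nat. if j = 0 then D else {})"
    by (auto simp: disjoint_family_on_def)
  ultimately have "indep_vars (\<lambda>_. borel)
      (\<lambda>j \<omega>. num_points (\<lambda>i. X i \<omega>) ((\<lambda>j::nat. if j = 0 then D else {}) j)) UNIV"
    using assms(1) unfolding poisson_point_process_def by blast
  then have "random_variable borel (\<lambda>\<omega>. num_points (\<lambda>i. X i \<omega>) (if (0::nat) = 0 then D else {}))"
    unfolding indep_vars_def by blast
  then show ?thesis by simp
qed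

text \<open>The generating function of a Poisson count of mean \<mu> at 1 - c: the exponential
  series sums to exp (- \<mu>) exp ((1 - c) \<mu>).\<close>

lemma nn_integral_thinning_gf_poisson:
  assumes ppp: "poisson_point_process lam X" and D: "D \<in> sets borel" "emeasure lborel D < \<infinity>"
    and "lam \<ge> 0" "c \<le> 1"
  shows "(\<integral>\<^sup>+\<omega>. thinning_gf c (num_points (\<lambda>i. X i \<omega>) D) \<partial>M)
    = ennreal (exp (- (lam * c * measure lborel D)))"
proof -
  let ?N = "\<lambda>\<omega>. num_points (\<lambda>i. X i \<omega>) D" and ?\<mu> = "lam * measure lborel D"
  note [measurable] = num_points_measurable_poisson[OF ppp D(1)]
  have "(\<integral>\<^sup>+\<omega>. thinning_gf c (?N \<omega>) \<partial>M)
      = (\<Sum>k. \<integral>\<^sup>+\<omega>. ennreal ((1 - c) ^ k) * indicator {of_nat k} (?N \<omega>) \<partial>M)"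
    unfolding thinning_gf_def by (rule nn_integral_suminf) measurable
  also have "\<dots> = (\<Sum>k. ennreal (exp (- ?\<mu>) * ((((1 - c) * ?\<mu>) ^ k) /\<^sub>R fact k)))"
  proof (rule suminf_cong)
    fix k :: nat
    have "(\<integral>\<^sup>+\<omega>. ennreal ((1 - c) ^ k) * indicator {of_nat k} (?N \<omega>) \<partial>M)
        = ennreal ((1 - c) ^ k) * (\<integral>\<^sup>+\<omega>. indicator {\<omega>\<in>space M. ?N \<omega> = of_nat k} \<omega> \<partial>M)"
      by (subst nn_integral_cmult[symmetric]) (auto intro!: nn_integral_cong simp: indicator_def)
    also have "\<dots> = ennreal ((1 - c) ^ k) * ennreal (\<P>(\<omega> in M. ?N \<omega> = of_nat k))"
      by (subst nn_integral_indicator) (auto simp: emeasure_eq_measure)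
    also have "\<P>(\<omega> in M. ?N \<omega> = of_nat k) = exp (- ?\<mu>) * ?\<mu> ^ k / fact k"
      using ppp D unfolding poisson_point_process_def by auto
    also have "ennreal ((1 - c) ^ k) * ennreal (exp (- ?\<mu>) * ?\<mu> ^ k / fact k)
        = ennreal ((1 - c) ^ k * (exp (- ?\<mu>) * ?\<mu> ^ k / fact k))"
      using \<open>lam \<ge> 0\<close> \<open>c \<le> 1\<close> by (intro ennreal_mult[symmetric]) auto
    finally show "(\<integral>\<^sup>+\<omega>. ennreal ((1 - c) ^ k) * indicator {of_nat k} (?N \<omega>) \<partial>M)
        = ennreal (exp (- ?\<mu>) * ((((1 - c) * ?\<mu>) ^ k) /\<^sub>R fact k))"
      by (simp add: power_mult_distrib divide_inverse_commute mult_ac)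
  qed
  also have "\<dots> = ennreal (exp (- ?\<mu>) * exp ((1 - c) * ?\<mu>))"
  proof (rule suminf_ennreal_eq)
    show "(\<lambda>k. exp (- ?\<mu>) * ((((1 - c) * ?\<mu>) ^ k) /\<^sub>R fact k)) sums (exp (- ?\<mu>) * exp ((1 - c) * ?\<mu>))"
      by (intro sums_mult exp_converges)
  qed (use \<open>lam \<ge> 0\<close> \<open>c \<le> 1\<close> in auto)
  also have "exp (- ?\<mu>) * exp ((1 - c) * ?\<mu>) = exp (- (lam * c * measure lborel D))"
    by (simp add: exp_add[symmetric] algebra_simps)
  finally show ?thesis .
qed

lemma AE_num_points_of_nat_poisson:
  assumes ppp: "poisson_point_process lam X" and D: "D \<in> sets borel" "emeasure lborel D < \<infinity>"
    and "lam \<ge> 0"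
  shows "AE \<omega> in M. \<exists>k. num_points (\<lambda>i. X i \<omega>) D = of_nat k"
proof -
  let ?N = "\<lambda>\<omega>. num_points (\<lambda>i. X i \<omega>) D"
  note [measurable] = num_points_measurable_poisson[OF ppp D(1)]
  \<comment> \<open>At c = 0 the function is the indicator of a finite count, so the value exp 0 = 1
    of its integral is the probability of a finite count.\<close>
  have *: "thinning_gf 0 (?N \<omega>) = indicator {\<omega>\<in>space M. \<exists>k. ?N \<omega> = of_nat k} \<omega>"
    if "\<omega> \<in> space M" for \<omega>
  proof (cases "\<exists>k. ?N \<omega> = of_nat k")
    case True
    then show ?thesis using that by (auto simp: thinning_gf_of_nat)
  next
    case False
    then show ?thesis by (simp add: thinning_gf_def indicator_def)
  qed
  have "(\<integral>\<^sup>+\<omega>. indicator {\<omega>\<in>space M. \<exists>k. ?N \<omega> = of_nat k} \<omega> \<partial>M) = 1"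
    using nn_integral_thinning_gf_poisson[OF assms, of 0] by (simp add: * cong: nn_integral_cong)
  then have "emeasure M {\<omega>\<in>space M. \<exists>k. ?N \<omega> = of_nat k} = 1"
    by (subst (asm) nn_integral_indicator) auto
  then have "AE \<omega> in M. \<omega> \<in> {\<omega>\<in>space M. \<exists>k. ?N \<omega> = of_nat k}"
    by (intro AE_prob_1) (simp add: measure_def)
  then show ?thesis by eventually_elim simp
qed

text \<open>The Laplace functional for step functions. After swapping the products, the points in
  each \<open>D j\<close> contribute a generating function of their count in the limit, and
  independence of the counts of disjoint sets factorises the integral. All factors lie in [0, 1], so
  the constant 1 dominates.\<close>

lemma poisson_prod_LIMSEQ:
  fixes D :: "nat \<Rightarrow> 'b::euclidean_space set"
  assumes ppp: "poisson_point_process lam X" and "lam \<ge> 0"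
    and D: "\<And>j. D j \<in> sets borel" "\<And>j. emeasure lborel (D j) < \<infinity>" "disjoint_family D"
    and c: "\<And>j. 0 \<le> c j" "\<And>j. c j \<le> 1"
  shows "(\<lambda>n. \<integral>\<^sup>+\<omega>. (\<Prod>i<n. \<Prod>j<m. ennreal (1 - c j * indicator (D j) (X i \<omega>))) \<partial>M)
    \<longlonglongrightarrow> ennreal (exp (- (lam * (\<Sum>j<m. c j * measure lborel (D j)))))"
proof -
  let ?N = "\<lambda>j \<omega>. num_points (\<lambda>i. X i \<omega>) (D j)"
  have [measurable]: "X i \<in> borel_measurable M" for i
    using ppp by (simp add: poisson_point_process_def)
  note [measurable] = D(1) num_points_measurable_poisson[OF ppp D(1)]
  have "(\<lambda>n. \<integral>\<^sup>+\<omega>. (\<Prod>i<n. \<Prod>j<m. ennreal (1 - c j * indicator (D j) (X i \<omega>))) \<partial>M)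
    \<longlonglongrightarrow> (\<integral>\<^sup>+\<omega>. (\<Prod>j<m. thinning_gf (c j) (?N j \<omega>)) \<partial>M)"
  proof (rule nn_integral_dominated_convergence[where w="\<lambda>_. 1"])
    show "AE \<omega> in M. (\<Prod>i<n. \<Prod>j<m. ennreal (1 - c j * indicator (D j) (X i \<omega>))) \<le> 1" for n
      using c by (intro AE_I2 prod_le_1 conjI) (auto simp: indicator_def)
    have "AE \<omega> in M. \<forall>j. \<exists>k. ?N j \<omega> = of_nat k"
      unfolding AE_all_countable using AE_num_points_of_nat_poisson[OF ppp D(1,2) \<open>lam \<ge> 0\<close>] by blast
    then show "AE \<omega> in M. (\<lambda>n. \<Prod>i<n. \<Prod>j<m. ennreal (1 - c j * indicator (D j) (X i \<omega>)))
        \<longlonglongrightarrow> (\<Prod>j<m. thinning_gf (c j) (?N j \<omega>))"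
    proof eventually_elim
      case (elim \<omega>)
      have *: "(\<lambda>n. \<Prod>i<n. ennreal (1 - c j * indicator (D j) (X i \<omega>))) \<longlonglongrightarrow> thinning_gf (c j) (?N j \<omega>)" for j
        using elim[rule_format, of j] LIMSEQ_prod_thinning[OF _ c(2)] by blast
      \<comment> \<open>Multiplication on \<open>ennreal\<close> is discontinuous where 0 meets
        \<top>, so the limits of the factors are first shown to be finite.\<close>
      have fin: "thinning_gf (c j) (?N j \<omega>) \<noteq> \<top>" for j
        using elim[rule_format, of j] by (auto simp: thinning_gf_of_nat)
      have "(\<lambda>n. \<Prod>j<m. \<Prod>i<n. ennreal (1 - c j * indicator (D j) (X i \<omega>)))
        \<longlonglongrightarrow> (\<Prod>j<m. thinning_gf (c j) (?N j \<omega>))"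
      proof (induction m)
        case (Suc m)
        have "(\<Prod>j<m. thinning_gf (c j) (?N j \<omega>)) \<noteq> \<top>"
          using fin by (simp add: ennreal_prod_eq_top)
        then show ?case
          unfolding prod.lessThan_Suc using fin[of m]
          by (intro tendsto_mult_ennreal Suc *) simp
      qed simp
      moreover have "(\<Prod>i<n. \<Prod>j<m. ennreal (1 - c j * indicator (D j) (X i \<omega>)))
          = (\<Prod>j<m. \<Prod>i<n. ennreal (1 - c j * indicator (D j) (X i \<omega>)))" for n
        by (rule prod.swap)
      ultimately show ?case by (simp only:)
    qed
  qed (auto simp: emeasure_space_1)
  also have "(\<integral>\<^sup>+\<omega>. (\<Prod>j<m. thinning_gf (c j) (?N j \<omega>)) \<partial>M)
      = (\<Prod>j<m. \<integral>\<^sup>+\<omega>. thinning_gf (c j) (?N j \<omega>) \<partial>M)"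
  proof (rule indep_vars_nn_integral)
    have "range D \<subseteq> sets borel" using D(1) by auto
    with ppp D(3) have "indep_vars (\<lambda>_. borel) ?N UNIV"
      unfolding poisson_point_process_def by simp
    from indep_vars_subset[OF this subset_UNIV]
    show "indep_vars (\<lambda>_. borel) (\<lambda>j \<omega>. thinning_gf (c j) (?N j \<omega>)) {..<m}"
      by (rule indep_vars_compose2) measurable
  qed auto
  also have "\<dots> = (\<Prod>j<m. ennreal (exp (- (lam * c j * measure lborel (D j)))))"
    using nn_integral_thinning_gf_poisson[OF ppp D(1,2) \<open>lam \<ge> 0\<close> c(2)] by simp
  also have "\<dots> = ennreal (exp (- (lam * (\<Sum>j<m. c j * measure lborel (D j)))))"
    by (simp add: prod_ennreal flip: exp_sum) (simp add: sum_distrib_left sum_negf mult.assoc)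
  finally show ?thesis .
qed


text \<open>Let \<open>g\<close> have the values \<open>c j\<close> on the level sets
  \<open>D j\<close>. As g \<le> u, the product of the factors 1 - c j on \<open>D j\<close>
  dominates 1 - u pointwise, and for that product the limit over \<open>n\<close> is known.\<close>

lemma poisson_prod_le_simple:
  fixes g :: "'b::euclidean_space \<Rightarrow> ennreal"
  assumes ppp: "poisson_point_process lam X" and "lam \<ge> 0"
    and u0: "\<And>x. 0 \<le> u x" and u: "\<And>x. u x \<le> 1" "(\<integral>\<^sup>+x. ennreal (u x) \<partial>lborel) < \<infinity>"
    and g: "simple_function lborel g" "\<And>x. g x \<le> ennreal (u x)"
    and p: "\<And>n. p \<le> (\<integral>\<^sup>+\<omega>. (\<Prod>i<n. ennreal (1 - u (X i \<omega>))) \<partial>M)"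
  shows "p \<le> ennreal (exp (- (lam * enn2real (\<integral>\<^sup>+x. g x \<partial>lborel))))"
proof -
  have g1: "g x \<le> 1" for x
    using order_trans[OF g(2)[of x], of 1] u(1)[of x] by simp
  \<comment> \<open>The value 0 is dropped because its level set may have infinite volume.\<close>
  have fin: "finite (range g - {0})"
    using simple_functionD(1)[OF g(1)] by simp
  obtain v m where v: "bij_betw v {..<m::nat} (range g - {0})"
    using ex_bij_betw_nat_finite[OF fin] by (auto simp: atLeast0LessThan)
  \<comment> \<open>Indices from \<open>m\<close> on get the empty set and weight 0, since the
    Poisson property is stated for infinite sequences of sets.\<close>
  define D where "D j = (if j < m then g -` {v j} else {})" for j
  define c where "c j = (if j < m then enn2real (v j) else 0)" for j
  have vD: "v j \<noteq> 0 \<and> v j \<le> 1 \<and> (\<exists>x. v j = g x)" if "j < m" for j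
  proof -
    have "v j \<in> range g - {0}" using bij_betwE[OF v] that by blast
    then show ?thesis using g1 by auto
  qed
  have v_c: "v j = ennreal (c j)" if "j < m" for j
    using vD[OF that] that by (auto simp: c_def ennreal_enn2real_if top_unique)
  have D_borel: "D j \<in> sets borel" for j
    using simple_functionD(2)[OF g(1), of "{v j}"] by (auto simp: D_def)
  \<comment> \<open>As in Markov's inequality, integrability of \<open>u\<close> bounds the volume
    of each level set with a nonzero value.\<close>
  have D_int: "v j * emeasure lborel (D j) \<le> (\<integral>\<^sup>+x. ennreal (u x) \<partial>lborel)" if "j < m" for j
  proof -
    have "v j * emeasure lborel (D j) = (\<integral>\<^sup>+x. v j * indicator (D j) x \<partial>lborel)"
      using D_borel by (simp add: nn_integral_cmult_indicator)
    also have "\<dots> \<le> (\<integral>\<^sup>+x. ennreal (u x) \<partial>lborel)"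
    proof (rule nn_integral_mono)
      fix x
      show "v j * indicator (D j) x \<le> ennreal (u x)"
        using that g(2)[of x] by (auto simp: D_def indicator_def)
    qed
    finally show ?thesis .
  qed
  have D_fin: "emeasure lborel (D j) < \<infinity>" for j
  proof (cases "j < m")
    case True
    then have "v j * emeasure lborel (D j) < \<infinity>"
      using D_int[OF True] u(2) by (rule_tac le_less_trans)
    then show ?thesis using vD[OF True] by (auto simp: ennreal_mult_less_top)
  qed (simp add: D_def)
  have D_disj: "disjoint_family D"
    using bij_betw_imp_inj_on[OF v] by (auto simp: disjoint_family_on_def D_def inj_on_def split: if_splits)
  have c01: "0 \<le> c j" "c j \<le> 1" for j
    using vD[of j] enn2real_mono[of "v j" 1] by (auto simp: c_def)
  have prod_ge: "ennreal (1 - u x) \<le> (\<Prod>j<m. ennreal (1 - c j * indicator (D j) x))" for x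
  proof (cases "g x = 0")
    case True
    then have "indicator (D j) x = (0::real)" if "j < m" for j
      using vD[OF that] that by (auto simp: D_def)
    then have "(\<Prod>j<m. ennreal (1 - c j * indicator (D j) x)) = 1" by simp
    then show ?thesis using u0[of x] by (simp add: ennreal_le_1)
  next
    case False
    then obtain k where k: "k < m" "v k = g x"
    proof -
      have "g x \<in> v ` {..<m}" using False bij_betw_imp_surj_on[OF v] by auto
      then show thesis using that by auto
    qed
    have "(\<Prod>j<m. ennreal (1 - c j * indicator (D j) x)) = (\<Prod>j\<in>{k}. ennreal (1 - c j * indicator (D j) x))"
    proof (rule prod.mono_neutral_right)
      show "\<forall>j\<in>{..<m} - {k}. ennreal (1 - c j * indicator (D j) x) = 1"
        using k bij_betw_imp_inj_on[OF v] by (auto simp: D_def inj_on_def indicator_def)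
    qed (use k in auto)
    also have "\<dots> = ennreal (1 - c k)" using k by (simp add: D_def)
    finally have eq: "(\<Prod>j<m. ennreal (1 - c j * indicator (D j) x)) = ennreal (1 - c k)" .
    have "ennreal (c k) \<le> ennreal (u x)" using g(2)[of x] v_c[OF k(1)] k by simp
    moreover have "c k > 0" using v_c[OF k(1)] vD[OF k(1)] by (auto simp: ennreal_eq_0_iff not_le)
    ultimately have "c k \<le> u x"
      by (metis ennreal_leI ennreal_le_iff2 linorder_not_less order.strict_iff_not)
    then show ?thesis unfolding eq by (intro ennreal_leI) simp
  qed
  have int_g: "(\<integral>\<^sup>+x. g x \<partial>lborel) = ennreal (\<Sum>j<m. c j * measure lborel (D j))"
  proof -
    have "(\<integral>\<^sup>+x. g x \<partial>lborel) = (\<Sum>y\<in>range g. y * emeasure lborel (g -` {y}))"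
      using g(1) by (simp add: nn_integral_eq_simple_integral simple_integral_def)
    also have "\<dots> = (\<Sum>y\<in>range g - {0}. y * emeasure lborel (g -` {y}))"
      using simple_functionD(1)[OF g(1)] by (intro sum.mono_neutral_right) auto
    also have "\<dots> = (\<Sum>j<m. v j * emeasure lborel (g -` {v j}))"
      by (rule sum.reindex_bij_betw[OF v, symmetric])
    also have "\<dots> = (\<Sum>j<m. ennreal (c j * measure lborel (D j)))"
    proof (rule sum.cong)
      fix j assume "j \<in> {..<m}"
      then have "v j * emeasure lborel (g -` {v j}) = ennreal (c j) * ennreal (measure lborel (D j))"
        using D_fin[of j] v_c[of j] by (simp add: D_def emeasure_eq_ennreal_measure)
      then show "v j * emeasure lborel (g -` {v j}) = ennreal (c j * measure lborel (D j))"
        using c01 by (simp add: ennreal_mult)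
    qed simp
    also have "\<dots> = ennreal (\<Sum>j<m. c j * measure lborel (D j))"
      using c01 by (intro sum_ennreal) auto
    finally show ?thesis .
  qed
  have nonneg: "0 \<le> (\<Sum>j<m. c j * measure lborel (D j))"
    using c01 by (intro sum_nonneg) auto
  have "p \<le> ennreal (exp (- (lam * (\<Sum>j<m. c j * measure lborel (D j)))))"
  proof (rule LIMSEQ_le_const[OF poisson_prod_LIMSEQ[OF ppp \<open>lam \<ge> 0\<close> D_borel D_fin D_disj c01]], intro exI allI impI)
    fix n
    show "p \<le> (\<integral>\<^sup>+\<omega>. (\<Prod>i<n. \<Prod>j<m. ennreal (1 - c j * indicator (D j) (X i \<omega>))) \<partial>M)"
      by (rule order_trans[OF p[of n]]) (intro nn_integral_mono prod_mono_ennreal prod_ge)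
  qed
  then show ?thesis unfolding int_g using nonneg by simp
qed

text \<open>Only the upper bound in the formula for the Laplace functional is needed; since the left-hand
  side decreases in \<open>u\<close>, it passes to the limit along simple functions below \<open>u\<close>.\<close>

lemma poisson_prod_le:
  fixes u :: "'b::euclidean_space \<Rightarrow> real"
  assumes ppp: "poisson_point_process lam X" and "lam \<ge> 0"
    and u [measurable]: "u \<in> borel_measurable borel" and u01: "\<And>x. 0 \<le> u x" "\<And>x. u x \<le> 1"
    and S: "(\<integral>\<^sup>+x. ennreal (u x) \<partial>lborel) = ennreal S" "S \<ge> 0"
    and p: "\<And>n. p \<le> (\<integral>\<^sup>+\<omega>. (\<Prod>i<n. ennreal (1 - u (X i \<omega>))) \<partial>M)"
  shows "p \<le> ennreal (exp (- (lam * S)))"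
proof -
  obtain f where f: "\<And>i. simple_function lborel (f i)" "incseq f" "\<And>x. (SUP i. f i x) = ennreal (u x)"
    by (rule borel_measurable_implies_simple_function_sequence'[of "\<lambda>x. ennreal (u x)" lborel]) (simp, blast)
  have le: "f i x \<le> ennreal (u x)" for i x
    unfolding f(3)[symmetric] by (rule SUP_upper) simp
  have "(\<lambda>i. \<integral>\<^sup>+x. f i x \<partial>lborel) \<longlonglongrightarrow> (SUP i. \<integral>\<^sup>+x. f i x \<partial>lborel)"
    using f(2) by (intro LIMSEQ_SUP) (auto simp: incseq_def le_fun_def intro!: nn_integral_mono)
  also have "(SUP i. \<integral>\<^sup>+x. f i x \<partial>lborel) = (\<integral>\<^sup>+x. (SUP i. f i x) \<partial>lborel)"
    using f(2) borel_measurable_simple_function[OF f(1)]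
    by (intro nn_integral_monotone_convergence_SUP[symmetric]) auto
  also have "\<dots> = ennreal S" by (simp add: f(3) S)
  finally have "(\<lambda>i. enn2real (\<integral>\<^sup>+x. f i x \<partial>lborel)) \<longlonglongrightarrow> S"
    using tendsto_enn2real[of _ S] S(2) by auto
  then have "(\<lambda>i. ennreal (exp (- (lam * enn2real (\<integral>\<^sup>+x. f i x \<partial>lborel))))) \<longlonglongrightarrow> ennreal (exp (- (lam * S)))"
    by (intro tendsto_ennrealI tendsto_exp tendsto_minus tendsto_mult tendsto_const)
  then show ?thesis
    by (rule LIMSEQ_le_const) (use poisson_prod_le_simple[OF ppp \<open>lam \<ge> 0\<close> u01 _ f(1) le p] S in auto)
qed

end

subsection \<open>Brownian increments\<close>

text \<open>In each coordinate a centred Gaussian density is largest at its centre.\<close>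

lemma normal_density_prod_le:
  fixes x :: "real ^ 'd"
  assumes "s > 0"
  shows "(\<Prod>k\<in>UNIV. normal_density 0 (sqrt s) (x $ k)) \<le> (1 / sqrt (2 * pi * s)) ^ CARD('d)"
proof -
  have "(\<Prod>k\<in>UNIV. normal_density 0 (sqrt s) (x $ k)) \<le> (\<Prod>k\<in>(UNIV::'d set). 1 / sqrt (2 * pi * s))"
  proof (rule prod_mono)
    fix k
    have "exp (- ((x $ k - 0)\<^sup>2 / (2 * (sqrt s)\<^sup>2))) \<le> 1" by simp
    then have "1 / sqrt (2 * pi * (sqrt s)\<^sup>2) * exp (- ((x $ k - 0)\<^sup>2 / (2 * (sqrt s)\<^sup>2)))
        \<le> 1 / sqrt (2 * pi * (sqrt s)\<^sup>2) * 1"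
      by (rule mult_left_mono) (use assms in simp)
    then show "0 \<le> normal_density 0 (sqrt s) (x $ k) \<and> normal_density 0 (sqrt s) (x $ k) \<le> 1 / sqrt (2 * pi * s)"
      using assms by (simp add: normal_density_def)
  qed
  then show ?thesis by simp
qed

lemma emeasure_lborel_translate:
  fixes y :: "'b::euclidean_space"
  assumes [measurable]: "B \<in> sets borel"
  shows "emeasure lborel {x. y + x \<in> B} = emeasure lborel B"
proof -
  have "emeasure lborel B = emeasure (distr lborel borel ((+) y)) B"
    by (simp add: lborel_distr_plus)
  also have "\<dots> = emeasure lborel {x. y + x \<in> B}"
    by (subst emeasure_distr) (auto simp: vimage_def)
  finally show ?thesis by simp
qed

context prob_space
begin

lemma brownian_measurable:
  "std_brownian_motion W \<Longrightarrow> s \<ge> 0 \<Longrightarrow> W s \<in> borel_measurable M"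
  by (simp add: std_brownian_motion_def)

lemma brownian_distributed_increment:
  fixes W :: "real \<Rightarrow> 'a \<Rightarrow> real ^ 'd"
  shows "std_brownian_motion W \<Longrightarrow> 0 \<le> s \<Longrightarrow> s < t \<Longrightarrow> distributed M lborel (\<lambda>\<omega>. W t \<omega> - W s \<omega>)
    (\<lambda>x. ennreal (\<Prod>k\<in>UNIV. normal_density 0 (sqrt (t - s)) (x $ k)))"
  by (simp add: std_brownian_motion_def)

lemma brownian_increment_emeasure_le:
  fixes W :: "real \<Rightarrow> 'a \<Rightarrow> real ^ 'd"
  assumes W: "std_brownian_motion W" and s: "0 \<le> s" "s < t" and B [measurable]: "B \<in> sets borel"
  shows "emeasure M {\<omega>\<in>space M. y + (W t \<omega> - W s \<omega>) \<in> B}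
    \<le> ennreal ((1 / sqrt (2 * pi * (t - s))) ^ CARD('d)) * emeasure lborel B"
proof -
  let ?f = "\<lambda>x::real^'d. ennreal (\<Prod>k\<in>UNIV. normal_density 0 (sqrt (t - s)) (x $ k))"
  have D: "distributed M lborel (\<lambda>\<omega>. W t \<omega> - W s \<omega>) ?f"
    by (rule brownian_distributed_increment[OF W s])
  have "emeasure M {\<omega>\<in>space M. y + (W t \<omega> - W s \<omega>) \<in> B}
      = emeasure M ((\<lambda>\<omega>. W t \<omega> - W s \<omega>) -` {x. y + x \<in> B} \<inter> space M)"
    by (rule arg_cong[where f="emeasure M"]) auto
  also have "\<dots> = (\<integral>\<^sup>+x. ?f x * indicator {x. y + x \<in> B} x \<partial>lborel)"
    by (rule distributed_emeasure[OF D]) measurable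
  also have "\<dots> \<le> (\<integral>\<^sup>+x. ennreal ((1 / sqrt (2 * pi * (t - s))) ^ CARD('d)) * indicator {x. y + x \<in> B} x \<partial>lborel)"
    using s by (intro nn_integral_mono mult_right_mono ennreal_leI normal_density_prod_le) auto
  also have "\<dots> = ennreal ((1 / sqrt (2 * pi * (t - s))) ^ CARD('d)) * emeasure lborel B"
    by (subst nn_integral_cmult_indicator) (auto simp: emeasure_lborel_translate)
  finally show ?thesis .
qed

text \<open>The density bound is only useful for \<open>t - s \<ge> l\<^sup>2\<close>; for shorter times the trivial bound 1 is better,
  and both are dominated by the two-dimensional rate.\<close>

lemma brownian_increment_prob_le:
  fixes W :: "real \<Rightarrow> 'a \<Rightarrow> real ^ 'd"
  assumes W: "std_brownian_motion W" and s: "0 \<le> s" "s < t" and B: "B \<in> sets borel"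
    and vol: "emeasure lborel B \<le> ennreal (l ^ CARD('d))" and "l \<ge> 0" and "CARD('d) \<ge> 2"
  shows "prob {\<omega>\<in>space M. y + (W t \<omega> - W s \<omega>) \<in> B} \<le> l\<^sup>2 / (2 * pi * (t - s))"
proof -
  let ?d = "CARD('d)" and ?r = "l / sqrt (2 * pi * (t - s))"
  have r0: "?r \<ge> 0" using \<open>l \<ge> 0\<close> s by simp
  have r2: "?r ^ 2 = l\<^sup>2 / (2 * pi * (t - s))" using s by (simp add: power_divide)
  show ?thesis
  proof (cases "?r \<le> 1")
    case True
    have "emeasure M {\<omega>\<in>space M. y + (W t \<omega> - W s \<omega>) \<in> B}
        \<le> ennreal ((1 / sqrt (2 * pi * (t - s))) ^ ?d) * ennreal (l ^ ?d)"
      by (rule order_trans[OF brownian_increment_emeasure_le[OF W s B]]) (intro mult_left_mono vol, simp)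
    also have "\<dots> = ennreal (?r ^ ?d)"
      using s \<open>l \<ge> 0\<close> by (simp add: ennreal_mult[symmetric] power_divide)
    finally have "prob {\<omega>\<in>space M. y + (W t \<omega> - W s \<omega>) \<in> B} \<le> ?r ^ ?d"
      using r0 by (simp add: emeasure_eq_measure)
    also have "\<dots> \<le> ?r ^ 2" using r0 True assms(7) by (intro power_decreasing)
    finally show ?thesis unfolding r2 .
  next
    case False
    have "prob {\<omega>\<in>space M. y + (W t \<omega> - W s \<omega>) \<in> B} \<le> 1" by simp
    also have "\<dots> \<le> ?r ^ 2" using False by (intro one_le_power) simp
    finally show ?thesis unfolding r2 .
  qed
qed

lemma brownian_indep_increment:
  fixes W :: "real \<Rightarrow> 'a \<Rightarrow> real ^ 'd"
  assumes W: "std_brownian_motion W" and s: "0 \<le> s" "s \<le> t"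
  shows "indep_var borel (\<lambda>\<omega>. W s \<omega> - W 0 \<omega>) borel (\<lambda>\<omega>. W t \<omega> - W s \<omega>)"
proof -
  \<comment> \<open>The times 0, s, t, t, ... are weakly increasing, as \<open>mono\<close> allows;
    the first two increments are the wanted ones and all later ones vanish.\<close>
  define \<tau> where "\<tau> j = (if j = 0 then 0 else if j = 1 then s else t)" for j :: nat
  have "mono \<tau>" using s by (auto simp: mono_def \<tau>_def)
  moreover have "0 \<le> \<tau> 0" by (simp add: \<tau>_def)
  ultimately have ind: "indep_vars (\<lambda>_. borel) (\<lambda>j \<omega>. W (\<tau> (Suc j)) \<omega> - W (\<tau> j) \<omega>) UNIV"
    using W \<open>0 \<le> \<tau> 0\<close> unfolding std_brownian_motion_def by blast
  have "indep_var borel ((\<lambda>f. f 0) \<circ> (\<lambda>\<omega>. restrict (\<lambda>j. W (\<tau> (Suc j)) \<omega> - W (\<tau> j) \<omega>) {0}))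
      borel ((\<lambda>f. f 1) \<circ> (\<lambda>\<omega>. restrict (\<lambda>j. W (\<tau> (Suc j)) \<omega> - W (\<tau> j) \<omega>) {1}))"
    by (rule indep_var_compose[OF indep_var_restrict[OF ind]]) auto
  then show ?thesis by (simp add: comp_def \<tau>_def)
qed

text \<open>The increment after time s is independent of the position at time s, and
  \<open>b\<close> bounds its chance of leading into \<open>B\<close> from every position y. The
  bound therefore survives integration over that position.\<close>

lemma brownian_joint_prob_le:
  fixes W :: "real \<Rightarrow> 'a \<Rightarrow> real ^ 'd"
  assumes W: "std_brownian_motion W" and s: "0 \<le> s" "s < t"
    and A [measurable]: "A \<in> sets borel" and B [measurable]: "B \<in> sets borel"
    and b: "\<And>y. prob {\<omega>\<in>space M. y + (W t \<omega> - W s \<omega>) \<in> B} \<le> b"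
  shows "prob {\<omega>\<in>space M. x + W s \<omega> \<in> A \<and> x + W t \<omega> \<in> B} \<le> b * prob {\<omega>\<in>space M. x + W s \<omega> \<in> A}"
proof -
  have [measurable]: "W 0 \<in> borel_measurable M" "W s \<in> borel_measurable M" "W t \<in> borel_measurable M"
    using brownian_measurable[OF W] s by auto
  have b0: "b \<ge> 0" using order_trans[OF measure_nonneg b] .
  let ?I = "\<lambda>\<omega>. W s \<omega> - W 0 \<omega>" and ?J = "\<lambda>\<omega>. W t \<omega> - W s \<omega>"
  have [measurable]: "?I \<in> borel_measurable M" "?J \<in> borel_measurable M" by measurable
  interpret J: prob_space "distr M borel ?J" by (rule prob_space_distr) measurable
  have AE0: "AE \<omega> in M. W 0 \<omega> = 0" using W by (simp add: std_brownian_motion_def)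
  have prod: "distr M borel ?I \<Otimes>\<^sub>M distr M borel ?J = distr M (borel \<Otimes>\<^sub>M borel) (\<lambda>\<omega>. (?I \<omega>, ?J \<omega>))"
    using brownian_indep_increment[OF W, of s t] s by (simp add: indep_var_distribution_eq)
  have "emeasure M {\<omega>\<in>space M. x + W s \<omega> \<in> A \<and> x + W t \<omega> \<in> B}
      = (\<integral>\<^sup>+\<omega>. indicator {\<omega>\<in>space M. x + W s \<omega> \<in> A \<and> x + W t \<omega> \<in> B} \<omega> \<partial>M)"
    by (rule nn_integral_indicator[symmetric]) measurable
  \<comment> \<open>Independence is available for increments; \<open>W 0 = 0\<close> almost surely
    lets the increment from time 0 replace \<open>W s\<close>.\<close>
  also have "\<dots> = (\<integral>\<^sup>+\<omega>. indicator A (x + ?I \<omega>) * indicator B (x + ?I \<omega> + ?J \<omega>) \<partial>M)"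
    by (rule nn_integral_cong_AE) (use AE0 AE_space in eventually_elim, auto simp: indicator_def)
  also have "\<dots> = (\<integral>\<^sup>+z. indicator A (x + fst z) * indicator B (x + fst z + snd z)
      \<partial>distr M (borel \<Otimes>\<^sub>M borel) (\<lambda>\<omega>. (?I \<omega>, ?J \<omega>)))"
    by (subst nn_integral_distr) auto
  also have "\<dots> = (\<integral>\<^sup>+v. \<integral>\<^sup>+w. indicator A (x + v) * indicator B (x + v + w) \<partial>distr M borel ?J \<partial>distr M borel ?I)"
    by (subst prod[symmetric], subst J.nn_integral_fst[symmetric]) auto
  also have "\<dots> \<le> (\<integral>\<^sup>+v. ennreal b * indicator A (x + v) \<partial>distr M borel ?I)"
  proof (rule nn_integral_mono)
    fix v :: "real^'d"
    have "(\<integral>\<^sup>+w. indicator B (x + v + w) \<partial>distr M borel ?J)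
        = (\<integral>\<^sup>+\<omega>. indicator {\<omega>\<in>space M. x + v + ?J \<omega> \<in> B} \<omega> \<partial>M)"
      by (subst nn_integral_distr, measurable, rule nn_integral_cong) (simp add: indicator_def)
    also have "\<dots> = emeasure M {\<omega>\<in>space M. x + v + ?J \<omega> \<in> B}"
      by (rule nn_integral_indicator) measurable
    also have "\<dots> \<le> ennreal b" using b[of "x + v"] by (simp add: emeasure_eq_measure ennreal_leI)
    finally have le: "(\<integral>\<^sup>+w. indicator B (x + v + w) \<partial>distr M borel ?J) \<le> ennreal b" .
    have "(\<integral>\<^sup>+w. indicator A (x + v) * indicator B (x + v + w) \<partial>distr M borel ?J)
        = indicator A (x + v) * (\<integral>\<^sup>+w. indicator B (x + v + w) \<partial>distr M borel ?J)"
      by (rule nn_integral_cmult) measurable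
    then show "(\<integral>\<^sup>+w. indicator A (x + v) * indicator B (x + v + w) \<partial>distr M borel ?J)
        \<le> ennreal b * indicator A (x + v)"
      using mult_left_mono[OF le, of "indicator A (x + v)"] by (simp add: mult.commute)
  qed
  also have "\<dots> = (\<integral>\<^sup>+\<omega>. ennreal b * indicator A (x + ?I \<omega>) \<partial>M)"
    by (subst nn_integral_distr) auto
  also have "\<dots> = (\<integral>\<^sup>+\<omega>. ennreal b * indicator {\<omega>\<in>space M. x + W s \<omega> \<in> A} \<omega> \<partial>M)"
    by (rule nn_integral_cong_AE) (use AE0 AE_space in eventually_elim, auto simp: indicator_def)
  also have "\<dots> = ennreal b * emeasure M {\<omega>\<in>space M. x + W s \<omega> \<in> A}"
    by (rule nn_integral_cmult_indicator) measurable
  finally show ?thesis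
    using b0 by (simp add: emeasure_eq_measure ennreal_mult[symmetric])
qed

text \<open>The law at time s is fixed by the definition: the increment from time 0 is Gaussian for
  s > 0 and vanishes for s = 0, where the density clause does not apply.\<close>

lemma brownian_prob_eq:
  fixes W W' :: "real \<Rightarrow> 'a \<Rightarrow> real ^ 'd"
  assumes W: "std_brownian_motion W" and W': "std_brownian_motion W'" and s: "0 \<le> s"
    and A [measurable]: "A \<in> sets borel"
  shows "prob {\<omega>\<in>space M. x + W s \<omega> \<in> A} = prob {\<omega>\<in>space M. x + W' s \<omega> \<in> A}"
proof -
  have zero: "prob {\<omega>\<in>space M. x + U s \<omega> \<in> A} = prob {\<omega>\<in>space M. x + (U s \<omega> - U 0 \<omega>) \<in> A}"
    if U: "std_brownian_motion U" for U :: "real \<Rightarrow> 'a \<Rightarrow> real ^ 'd"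
  proof -
    have [measurable]: "U 0 \<in> borel_measurable M" "U s \<in> borel_measurable M"
      using brownian_measurable[OF U] s by auto
    have "AE \<omega> in M. U 0 \<omega> = 0" using U by (simp add: std_brownian_motion_def)
    then show ?thesis
      by (intro finite_measure_eq_AE) (auto elim!: AE_mp)
  qed
  show ?thesis
  proof (cases "s = 0")
    case True
    then show ?thesis using zero[OF W] zero[OF W'] by simp
  next
    case False
    have "measure M ((\<lambda>\<omega>. U s \<omega> - U 0 \<omega>) -` {z. x + z \<in> A} \<inter> space M)
        = measure (density lborel (\<lambda>x. ennreal (\<Prod>k\<in>UNIV. normal_density 0 (sqrt (s - 0)) (x $ k)))) {z. x + z \<in> A}"
      if U: "std_brownian_motion U" for U :: "real \<Rightarrow> 'a \<Rightarrow> real ^ 'd"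
    proof -
      have D: "distributed M lborel (\<lambda>\<omega>. U s \<omega> - U 0 \<omega>)
          (\<lambda>x. ennreal (\<Prod>k\<in>UNIV. normal_density 0 (sqrt (s - 0)) (x $ k)))"
        by (rule brownian_distributed_increment[OF U]) (use s False in auto)
      show ?thesis
        unfolding distributed_distr_eq_density[OF D, symmetric]
        by (rule measure_distr[symmetric, OF distributed_measurable[OF D]]) measurable
    qed
    from this[OF W] this[OF W'] show ?thesis
      unfolding zero[OF W] zero[OF W'] by (simp add: vimage_def Int_def conj_commute)
  qed
qed

text \<open>Fubini and translation invariance: Lebesgue measure is preserved on averaging over a
  random displacement. This is why the mean number of nodes in a cell does not depend on
  time.\<close>

lemma nn_integral_translate_prob:
  fixes Z :: "'a \<Rightarrow> 'b::euclidean_space"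
  assumes [measurable]: "Z \<in> borel_measurable M" "B \<in> sets borel"
  shows "(\<integral>\<^sup>+x. emeasure M {\<omega>\<in>space M. x + Z \<omega> \<in> B} \<partial>lborel) = emeasure lborel B"
proof -
  interpret P: pair_sigma_finite M "lborel :: 'b measure" by unfold_locales
  have "(\<integral>\<^sup>+x. emeasure M {\<omega>\<in>space M. x + Z \<omega> \<in> B} \<partial>lborel)
      = (\<integral>\<^sup>+x. \<integral>\<^sup>+\<omega>. indicator B (x + Z \<omega>) \<partial>M \<partial>lborel)"
  proof (rule nn_integral_cong)
    fix x
    have "emeasure M {\<omega>\<in>space M. x + Z \<omega> \<in> B} = (\<integral>\<^sup>+\<omega>. indicator {\<omega>\<in>space M. x + Z \<omega> \<in> B} \<omega> \<partial>M)"
      by (rule nn_integral_indicator[symmetric]) measurable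
    also have "\<dots> = (\<integral>\<^sup>+\<omega>. indicator B (x + Z \<omega>) \<partial>M)"
      by (intro nn_integral_cong) (auto simp: indicator_def)
    finally show "emeasure M {\<omega>\<in>space M. x + Z \<omega> \<in> B} = (\<integral>\<^sup>+\<omega>. indicator B (x + Z \<omega>) \<partial>M)" .
  qed
  also have "\<dots> = (\<integral>\<^sup>+\<omega>. \<integral>\<^sup>+x. indicator B (x + Z \<omega>) \<partial>lborel \<partial>M)"
    by (rule P.Fubini') measurable
  also have "\<dots> = (\<integral>\<^sup>+\<omega>. emeasure lborel B \<partial>M)"
  proof (rule nn_integral_cong)
    fix \<omega>
    have "(\<integral>\<^sup>+x. indicator B (x + Z \<omega>) \<partial>lborel) = (\<integral>\<^sup>+x. indicator {x. Z \<omega> + x \<in> B} x \<partial>lborel)"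
      by (intro nn_integral_cong) (auto simp: indicator_def add.commute)
    also have "\<dots> = emeasure lborel {x. Z \<omega> + x \<in> B}"
      by (rule nn_integral_indicator) measurable
    finally show "(\<integral>\<^sup>+x. indicator B (x + Z \<omega>) \<partial>lborel) = emeasure lborel B"
      by (simp add: emeasure_lborel_translate)
  qed
  also have "\<dots> = emeasure lborel B" by (simp add: emeasure_space_1)
  finally show ?thesis .
qed

end

subsection \<open>Lower deviations of the number of visits\<close>

text \<open>The product of 1 + x + x^2/2 and 1 - x + x^2/2 is 1 + x^4/4 \<ge> 1, and the first
  factor is at most exp x.\<close>

lemma exp_minus_le_quadratic:
  fixes x :: real
  assumes "x \<ge> 0"
  shows "exp (- x) \<le> 1 - x + x\<^sup>2 / 2"
proof -
  have "1 \<le> (1 + x + x\<^sup>2 / 2) * (1 - x + x\<^sup>2 / 2)"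
  proof -
    have "(1 + x + x\<^sup>2 / 2) * (1 - x + x\<^sup>2 / 2) = 1 + (x\<^sup>2)\<^sup>2 / 4"
      by (simp add: field_simps power2_eq_square)
    then show ?thesis by simp
  qed
  also have "\<dots> \<le> exp x * (1 - x + x\<^sup>2 / 2)"
  proof (rule mult_right_mono[OF exp_lower_Taylor_quadratic[OF assms]])
    have eq: "1 - x + x\<^sup>2 / 2 = ((1 - x)\<^sup>2 + 1) / 2" by (simp add: power2_eq_square field_simps)
    show "0 \<le> 1 - x + x\<^sup>2 / 2" unfolding eq by (intro divide_nonneg_nonneg add_nonneg_nonneg) auto
  qed
  finally show ?thesis by (simp add: exp_minus field_simps)
qed

definition visits :: "(nat \<times> (real ^ 'd) set) set \<Rightarrow> real ^ 'd \<Rightarrow> (real \<Rightarrow> real ^ 'd) \<Rightarrow> real" where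
  "visits F x y = (\<Sum>f\<in>F. indicator (snd f) (x + y (real (fst f))))"

text \<open>Through this series, counts of moved nodes are measurable term by term, without any
  distributional property of the moved nodes.\<close>

lemma num_points_eq_suminf: "num_points x B = (\<Sum>i. indicator B (x i))"
proof -
  have "num_points x B = (\<integral>\<^sup>+i. indicator {i. x i \<in> B} i \<partial>count_space UNIV)"
    by (simp add: num_points_def)
  also have "\<dots> = (\<Sum>i. indicator {i. x i \<in> B} i)"
    by (rule nn_integral_count_space_nat)
  finally show ?thesis by (simp add: indicator_def)
qed

lemma sum_indicator_le_num_points: "ennreal (\<Sum>i<n. indicator B (x i)) \<le> num_points x B"
proof -
  have "ennreal (\<Sum>i<n. indicator B (x i)) = (\<Sum>i<n. indicator B (x i))"
    by (subst sum_ennreal[symmetric]) (auto simp: indicator_def ennreal_of_nat_eq_real_of_nat)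
  also have "\<dots> \<le> num_points x B"
    unfolding num_points_eq_suminf by (rule sum_le_suminf) auto
  finally show ?thesis .
qed

lemma trajectory_nat [simp]: "trajectory W \<omega> (real i) = W (real i) \<omega>"
  by (simp add: trajectory_def)

lemma visits_measurable:
  assumes "\<And>f. f \<in> F \<Longrightarrow> snd f \<in> sets borel"
  shows "(\<lambda>z. visits F (fst z) (snd z)) \<in> borel_measurable (borel \<Otimes>\<^sub>M trajectory_space)"
  unfolding visits_def
proof (rule borel_measurable_sum)
  fix f assume "f \<in> F"
  note [measurable] = assms[OF this]
  show "(\<lambda>z. indicator (snd f) (fst z + snd z (real (fst f)))) \<in> borel_measurable (borel \<Otimes>\<^sub>M trajectory_space)"
    by measurable
qed

context mobile_nodes
begin

lemma num_points_node_pos_measurable [measurable]: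
  assumes [measurable]: "B \<in> sets borel"
  shows "(\<lambda>\<omega>. num_points (node_pos X \<zeta> (real i) \<omega>) B) \<in> borel_measurable M"
  unfolding num_points_eq_suminf node_pos_def by measurable

text \<open>Motion 0 stands for all motions, which have the same law at a fixed time; see
  \<open>occupation_eq\<close>.\<close>

definition occupation :: "nat \<times> (real ^ 'd) set \<Rightarrow> real ^ 'd \<Rightarrow> real" where
  "occupation f x = prob {\<omega>\<in>space M. x + \<zeta> 0 (real (fst f)) \<omega> \<in> snd f}"

lemma occupation_eq:
  "snd f \<in> sets borel \<Longrightarrow> occupation f x = prob {\<omega>\<in>space M. x + \<zeta> k (real (fst f)) \<omega> \<in> snd f}"
  unfolding occupation_def by (rule brownian_prob_eq[OF brownian brownian]) auto

lemma occupation_nonneg: "0 \<le> occupation f x"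
  by (simp add: occupation_def)

lemma occupation_measurable:
  assumes [measurable]: "snd f \<in> sets borel"
  shows "occupation f \<in> borel_measurable borel"
proof -
  have "emeasure M {\<omega>\<in>space M. x + \<zeta> 0 (real (fst f)) \<omega> \<in> snd f}
      = (\<integral>\<^sup>+\<omega>. indicator (snd f) (x + \<zeta> 0 (real (fst f)) \<omega>) \<partial>M)" for x
    by (subst nn_integral_indicator[symmetric], measurable, rule nn_integral_cong) (simp add: indicator_def)
  then have "occupation f = (\<lambda>x. enn2real (\<integral>\<^sup>+\<omega>. indicator (snd f) (x + \<zeta> 0 (real (fst f)) \<omega>) \<partial>M))"
    by (intro ext) (simp add: occupation_def measure_def)
  also have "\<dots> \<in> borel_measurable borel" by measurable
  finally show ?thesis .
qed

lemma nn_integral_occupation: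
  assumes "snd f \<in> sets borel"
  shows "(\<integral>\<^sup>+x. ennreal (occupation f x) \<partial>lborel) = emeasure lborel (snd f)"
  using nn_integral_translate_prob[of "\<zeta> 0 (real (fst f))" "snd f"] assms
  by (simp add: occupation_def emeasure_eq_measure)

text \<open>A second moment bound for one path. Expanding E V^2, the diagonal gives E V, and two
  visits f before g have joint probability at most
  \<open>occupation f x * b (fst g - fst f)\<close>. Summing over g gives E V^2 \<le> R E V, which
  enters the quadratic bound for exp (- \<theta> V).\<close>

lemma nn_integral_exp_visits_le:
  assumes F: "finite F" "inj_on fst F" and borel: "\<And>f. f \<in> F \<Longrightarrow> snd f \<in> sets borel"
    and b: "\<And>f i y. f \<in> F \<Longrightarrow> i < fst f \<Longrightarrow>
      prob {\<omega>\<in>space M. y + (\<zeta> k (real (fst f)) \<omega> - \<zeta> k (real i) \<omega>) \<in> snd f} \<le> b (fst f - i)"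
    and R: "\<And>f. f \<in> F \<Longrightarrow> 1 + 2 * (\<Sum>g\<in>{g\<in>F. fst f < fst g}. b (fst g - fst f)) \<le> R"
    and "\<theta> \<ge> 0"
  shows "(\<integral>\<^sup>+\<omega>. ennreal (exp (- (\<theta> * visits F x (trajectory (\<zeta> k) \<omega>)))) \<partial>M)
    \<le> ennreal (1 - (\<theta> - \<theta>\<^sup>2 * R / 2) * (\<Sum>f\<in>F. occupation f x))" (is "_ \<le> ennreal ?rhs")
    and "0 \<le> 1 - (\<theta> - \<theta>\<^sup>2 * R / 2) * (\<Sum>f\<in>F. occupation f x)"
proof -
  let ?I = "\<lambda>f \<omega>. indicator (snd f) (x + \<zeta> k (real (fst f)) \<omega>) :: real"
  let ?V = "\<lambda>\<omega>. \<Sum>f\<in>F. ?I f \<omega>"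
  let ?J = "\<lambda>f g. expectation (\<lambda>\<omega>. ?I f \<omega> * ?I g \<omega>)"
  have meas: "?I f \<in> borel_measurable M" if "f \<in> F" for f
    using borel[OF that] by measurable
  have int_I [simp]: "integrable M (?I f)" if "f \<in> F" for f
    using that by (intro integrable_const_bound[where B=1] borel_measurable_times meas) (auto simp: indicator_def)
  have int_II [simp]: "integrable M (\<lambda>\<omega>. ?I f \<omega> * ?I g \<omega>)" if "f \<in> F" "g \<in> F" for f g
    using that by (intro integrable_const_bound[where B=1] borel_measurable_times meas) (auto simp: indicator_def)
  have sq: "(?V \<omega>)\<^sup>2 = (\<Sum>f\<in>F. \<Sum>g\<in>F. ?I f \<omega> * ?I g \<omega>)" for \<omega>
    by (simp add: power2_eq_square sum_product)
  have V0: "0 \<le> ?V \<omega>" for \<omega> by (intro sum_nonneg) auto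
  have int_V: "integrable M ?V" by simp
  have int_V2: "integrable M (\<lambda>\<omega>. (?V \<omega>)\<^sup>2)" unfolding sq by simp
  have [measurable]: "?V \<in> borel_measurable M" using int_V by (rule borel_measurable_integrable)
  have int_exp: "integrable M (\<lambda>\<omega>. exp (- (\<theta> * ?V \<omega>)))"
    using V0 \<open>\<theta> \<ge> 0\<close> by (intro integrable_const_bound[where B=1]) auto
  have EI: "expectation (?I f) = occupation f x" if "f \<in> F" for f
  proof -
    have "expectation (?I f) = expectation (indicator {\<omega>\<in>space M. x + \<zeta> k (real (fst f)) \<omega> \<in> snd f})"
      by (rule Bochner_Integration.integral_cong) (auto simp: indicator_def)
    then show ?thesis using borel[OF that] by (simp add: occupation_eq[of f x k])
  qed
  have EV: "expectation ?V = (\<Sum>f\<in>F. occupation f x)"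
    by (simp add: EI)
  have Jle: "?J f g \<le> occupation f x * b (fst g - fst f)"
    if fg: "f \<in> F" "g \<in> F" "fst f < fst g" for f g
  proof -
    let ?E = "{\<omega>\<in>space M. x + \<zeta> k (real (fst f)) \<omega> \<in> snd f \<and> x + \<zeta> k (real (fst g)) \<omega> \<in> snd g}"
    note [measurable] = borel[OF fg(1)] borel[OF fg(2)]
    have "?J f g = expectation (indicator ?E)"
      by (rule Bochner_Integration.integral_cong) (auto simp: indicator_def)
    also have "\<dots> = prob ?E" by simp
    also have "\<dots> \<le> b (fst g - fst f) * prob {\<omega>\<in>space M. x + \<zeta> k (real (fst f)) \<omega> \<in> snd f}"
      using fg by (intro brownian_joint_prob_le[OF brownian] b) auto
    finally show ?thesis using occupation_eq[of f x k] by (simp add: mult.commute)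
  qed
  have EV2: "expectation (\<lambda>\<omega>. (?V \<omega>)\<^sup>2) \<le> R * (\<Sum>f\<in>F. occupation f x)"
  proof -
    \<comment> \<open>Each off-diagonal pair is charged to its earlier member; by symmetry the two
      double sums of \<open>?T\<close> agree, which is the factor 2 in the hypothesis on
      \<open>R\<close>.\<close>
    let ?T = "\<lambda>f g. if fst f < fst g then occupation f x * b (fst g - fst f) else 0"
    have "expectation (\<lambda>\<omega>. (?V \<omega>)\<^sup>2) = (\<Sum>f\<in>F. \<Sum>g\<in>F. ?J f g)"
      unfolding sq by simp
    also have "\<dots> \<le> (\<Sum>f\<in>F. \<Sum>g\<in>F. (if g = f then occupation f x else 0) + ?T f g + ?T g f)"
    proof (intro sum_mono)
      fix f g assume fg: "f \<in> F" "g \<in> F"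
      \<comment> \<open>Distinct elements of \<open>F\<close> have distinct times because
        \<open>fst\<close> is injective on \<open>F\<close>.\<close>
      consider "f = g" | "fst f < fst g" | "fst g < fst f"
        using fg F(2) by (metis inj_onD linorder_neqE_nat)
      then show "?J f g \<le> (if g = f then occupation f x else 0) + ?T f g + ?T g f"
      proof cases
        case 1
        have "?J f f = expectation (?I f)"
          by (rule Bochner_Integration.integral_cong) (auto simp: indicator_def)
        then show ?thesis using EI[OF fg(1)] 1 by simp
      next
        case 2
        then show ?thesis using Jle[OF fg] by auto
      next
        case 3
        then show ?thesis using Jle[OF fg(2,1)] by (auto simp: mult.commute)
      qed
    qed
    also have "\<dots> = (\<Sum>f\<in>F. occupation f x) + (\<Sum>f\<in>F. \<Sum>g\<in>F. ?T f g) + (\<Sum>f\<in>F. \<Sum>g\<in>F. ?T g f)"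
      using F(1) by (simp add: sum.distrib)
    also have "(\<Sum>f\<in>F. \<Sum>g\<in>F. ?T g f) = (\<Sum>f\<in>F. \<Sum>g\<in>F. ?T f g)"
      by (rule sum.swap)
    also have "(\<Sum>f\<in>F. occupation f x) + (\<Sum>f\<in>F. \<Sum>g\<in>F. ?T f g) + (\<Sum>f\<in>F. \<Sum>g\<in>F. ?T f g)
        = (\<Sum>f\<in>F. occupation f x * (1 + 2 * (\<Sum>g\<in>{g\<in>F. fst f < fst g}. b (fst g - fst f))))"
      using F(1) by (simp add: sum.inter_filter[symmetric] sum_distrib_left algebra_simps sum.distrib)
    also have "\<dots> \<le> (\<Sum>f\<in>F. occupation f x * R)"
      by (intro sum_mono mult_left_mono R occupation_nonneg)
    finally show ?thesis by (simp add: sum_distrib_left mult.commute)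
  qed
  have "expectation (\<lambda>\<omega>. exp (- (\<theta> * ?V \<omega>))) \<le> expectation (\<lambda>\<omega>. 1 - \<theta> * ?V \<omega> + (\<theta> * ?V \<omega>)\<^sup>2 / 2)"
    using V0 \<open>\<theta> \<ge> 0\<close> int_V int_V2
    by (intro integral_mono int_exp exp_minus_le_quadratic) (auto simp: power_mult_distrib)
  also have "\<dots> = 1 - \<theta> * expectation ?V + \<theta>\<^sup>2 / 2 * expectation (\<lambda>\<omega>. (?V \<omega>)\<^sup>2)"
    using int_V int_V2 by (simp add: power_mult_distrib prob_space del: Bochner_Integration.integral_sum)
  also have "\<dots> \<le> 1 - \<theta> * (\<Sum>f\<in>F. occupation f x) + \<theta>\<^sup>2 / 2 * (R * (\<Sum>f\<in>F. occupation f x))"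
    unfolding EV by (intro add_left_mono mult_left_mono EV2) simp
  also have "\<dots> = ?rhs" by (simp add: algebra_simps)
  finally have le: "expectation (\<lambda>\<omega>. exp (- (\<theta> * ?V \<omega>))) \<le> ?rhs" .
  have "(\<integral>\<^sup>+\<omega>. ennreal (exp (- (\<theta> * visits F x (trajectory (\<zeta> k) \<omega>)))) \<partial>M)
      = ennreal (expectation (\<lambda>\<omega>. exp (- (\<theta> * ?V \<omega>))))"
    unfolding visits_def trajectory_nat by (rule nn_integral_eq_integral[OF int_exp]) simp
  also have "\<dots> \<le> ennreal ?rhs" using le by (rule ennreal_leI)
  finally show "(\<integral>\<^sup>+\<omega>. ennreal (exp (- (\<theta> * visits F x (trajectory (\<zeta> k) \<omega>)))) \<partial>M) \<le> ennreal ?rhs" .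
  \<comment> \<open>The bound lies above the mean of a positive variable. This is what makes the
    function \<open>u\<close> of the next lemma at most 1, as \<open>poisson_prod_le\<close>
    requires.\<close>
  have "0 \<le> expectation (\<lambda>\<omega>. exp (- (\<theta> * ?V \<omega>)))" by (rule Bochner_Integration.integral_nonneg) simp
  then show "0 \<le> ?rhs" using le by linarith
qed

text \<open>On the event, the visits of the first n nodes add up to at most \<open>?m * K\<close>
  for every n. The exponential Chebyshev inequality turns this into a lower bound, uniform in n, for
  the product to which the Laplace functional applies.\<close>

lemma prob_underpopulated_le:
  assumes F: "finite F" "inj_on fst F" and borel: "\<And>f. f \<in> F \<Longrightarrow> snd f \<in> sets borel"
    and vol: "\<And>f. f \<in> F \<Longrightarrow> emeasure lborel (snd f) = ennreal v" "v \<ge> 0"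
    and b: "\<And>f i k y. f \<in> F \<Longrightarrow> i < fst f \<Longrightarrow>
      prob {\<omega>\<in>space M. y + (\<zeta> k (real (fst f)) \<omega> - \<zeta> k (real i) \<omega>) \<in> snd f} \<le> b (fst f - i)"
    and R: "\<And>f. f \<in> F \<Longrightarrow> 1 + 2 * (\<Sum>g\<in>{g\<in>F. fst f < fst g}. b (fst g - fst f)) \<le> R" "R \<ge> 1"
    and \<xi>: "0 < \<xi>" "\<xi> < 1" and lam: "lam \<ge> 0"
  shows "prob {\<omega>\<in>space M. \<forall>f\<in>F. num_points (node_pos X \<zeta> (real (fst f)) \<omega>) (snd f) < ennreal ((1 - \<xi>) * lam * v)}
    \<le> exp (- (lam * v * \<xi>\<^sup>2 / (2 * R) * card F))" (is "prob ?E \<le> _")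
proof -
  \<comment> \<open>The final exponent is lam v m (- \<theta> \<xi> + \<theta>^2 R / 2) with m the
    size of \<open>F\<close>; it is minimal at \<theta> = \<xi> / R, with value - lam v m \<xi>^2 /
    (2 R).\<close>
  define \<theta> where "\<theta> = \<xi> / R"
  define a where "a = \<theta> - \<theta>\<^sup>2 * R / 2"
  \<comment> \<open>1 - u x is the bound just proved for the Laplace transform of the visits of a
    path from x.\<close>
  define u where "u x = a * (\<Sum>f\<in>F. occupation f x)" for x
  define K where "K = (1 - \<xi>) * lam * v"
  let ?m = "real (card F)"
  have \<theta>: "\<theta> \<ge> 0" using \<xi> R(2) by (simp add: \<theta>_def)
  have a_eq: "a = (\<xi> - \<xi>\<^sup>2 / 2) / R"
    using R(2) by (simp add: a_def \<theta>_def field_simps power2_eq_square)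
  have "\<xi>\<^sup>2 / 2 \<le> \<xi>" using \<xi> by (simp add: power2_eq_square mult_le_one)
  then have a0: "a \<ge> 0" unfolding a_eq using R(2) by simp
  have K0: "K \<ge> 0" using \<xi> lam vol(2) by (simp add: K_def)
  have u_meas [measurable]: "u \<in> borel_measurable borel"
    unfolding u_def using occupation_measurable[OF borel] by measurable
  have u0: "0 \<le> u x" for x
    unfolding u_def by (intro mult_nonneg_nonneg a0 sum_nonneg occupation_nonneg)
  have u1: "0 \<le> 1 - u x" for x
    unfolding u_def a_def by (rule nn_integral_exp_visits_le(2)[OF F borel b R(1) \<theta>])
  have E_sets [measurable]: "?E \<in> events"
  proof -
    have "{\<omega>\<in>space M. num_points (node_pos X \<zeta> (real (fst f)) \<omega>) (snd f) < ennreal ((1 - \<xi>) * lam * v)} \<in> events"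
      if "f \<in> F" for f
      using borel[OF that] by measurable
    then show ?thesis by (rule sets.sets_Collect_finite_All[OF _ F(1)])
  qed
  have low: "emeasure M ?E * ennreal (exp (- (\<theta> * (?m * K))))
      \<le> (\<integral>\<^sup>+\<omega>. (\<Prod>i<n. ennreal (1 - u (X i \<omega>))) \<partial>M)" for n
  proof -
    have "emeasure M ?E * ennreal (exp (- (\<theta> * (?m * K))))
        = (\<integral>\<^sup>+\<omega>. ennreal (exp (- (\<theta> * (?m * K)))) * indicator ?E \<omega> \<partial>M)"
      using nn_integral_cmult_indicator[OF E_sets] by (simp only: mult.commute)
    also have "\<dots> \<le> (\<integral>\<^sup>+\<omega>. (\<Prod>i<n. ennreal (exp (- (\<theta> * visits F (X i \<omega>) (trajectory (\<zeta> i) \<omega>))))) \<partial>M)"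
    proof (rule nn_integral_mono)
      fix \<omega>
      have "(\<Sum>i<n. visits F (X i \<omega>) (trajectory (\<zeta> i) \<omega>)) \<le> ?m * K" if E: "\<omega> \<in> ?E"
      proof -
        \<comment> \<open>Summing over pairs instead of nodes turns visits into counts; restricting
          to the first n nodes only lowers them.\<close>
        have "(\<Sum>i<n. visits F (X i \<omega>) (trajectory (\<zeta> i) \<omega>))
            = (\<Sum>f\<in>F. \<Sum>i<n. indicator (snd f) (node_pos X \<zeta> (real (fst f)) \<omega> i))"
          unfolding visits_def trajectory_nat node_pos_def by (rule sum.swap)
        also have "\<dots> \<le> (\<Sum>f\<in>F. K)"
        proof (rule sum_mono)
          fix f assume "f \<in> F"
          have "ennreal (\<Sum>i<n. indicator (snd f) (node_pos X \<zeta> (real (fst f)) \<omega> i))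
              \<le> num_points (node_pos X \<zeta> (real (fst f)) \<omega>) (snd f)"
            by (rule sum_indicator_le_num_points)
          also have "\<dots> \<le> ennreal K"
            using E \<open>f \<in> F\<close> by (auto simp: K_def)
          finally have "ennreal (\<Sum>i<n. indicator (snd f) (node_pos X \<zeta> (real (fst f)) \<omega> i)) \<le> ennreal K" .
          then show "(\<Sum>i<n. indicator (snd f) (node_pos X \<zeta> (real (fst f)) \<omega> i)) \<le> K"
            using K0 by simp
        qed
        finally show ?thesis by simp
      qed
      then have "exp (- (\<theta> * (?m * K))) \<le> exp (- (\<theta> * (\<Sum>i<n. visits F (X i \<omega>) (trajectory (\<zeta> i) \<omega>))))"
        if "\<omega> \<in> ?E" using that \<theta> by (simp add: mult_left_mono)
      moreover have "(\<Prod>i<n. ennreal (exp (- (\<theta> * visits F (X i \<omega>) (trajectory (\<zeta> i) \<omega>)))))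
          = ennreal (exp (- (\<theta> * (\<Sum>i<n. visits F (X i \<omega>) (trajectory (\<zeta> i) \<omega>)))))"
        by (simp add: prod_ennreal exp_sum[symmetric] sum_distrib_left sum_negf)
      ultimately show "ennreal (exp (- (\<theta> * (?m * K)))) * indicator ?E \<omega>
          \<le> (\<Prod>i<n. ennreal (exp (- (\<theta> * visits F (X i \<omega>) (trajectory (\<zeta> i) \<omega>)))))"
        by (cases "\<omega> \<in> ?E") (auto intro!: ennreal_leI)
    qed
    also have "\<dots> \<le> (\<integral>\<^sup>+\<omega>. (\<Prod>i<n. ennreal (1 - u (X i \<omega>))) \<partial>M)"
    proof -
      note [measurable] = visits_measurable[OF borel]
      have "(\<lambda>z. ennreal (exp (- (\<theta> * visits F (fst z) (snd z))))) \<in> borel_measurable (borel \<Otimes>\<^sub>M trajectory_space)"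
        by measurable
      from nn_integral_prod_paths_le[OF this, of "\<lambda>x. ennreal (1 - u x)" n] show ?thesis
        using nn_integral_exp_visits_le(1)[OF F borel b R(1) \<theta>, folded a_def, folded u_def] by simp
    qed
    finally show ?thesis .
  qed
  \<comment> \<open>By translation invariance every pair contributes \<open>v\<close> to the
    integral, whatever its time.\<close>
  have S: "(\<integral>\<^sup>+x. ennreal (u x) \<partial>lborel) = ennreal (a * (?m * v))"
  proof -
    have "(\<integral>\<^sup>+x. ennreal (u x) \<partial>lborel) = (\<integral>\<^sup>+x. ennreal a * (\<Sum>f\<in>F. ennreal (occupation f x)) \<partial>lborel)"
      by (simp add: u_def ennreal_mult a0 occupation_nonneg sum_nonneg)
    also have "\<dots> = ennreal a * (\<Sum>f\<in>F. \<integral>\<^sup>+x. ennreal (occupation f x) \<partial>lborel)"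
      using occupation_measurable[OF borel]
      by (subst nn_integral_cmult) (auto simp: nn_integral_sum intro!: borel_measurable_sum)
    also have "(\<Sum>f\<in>F. \<integral>\<^sup>+x. ennreal (occupation f x) \<partial>lborel) = (\<Sum>f\<in>F. ennreal v)"
      by (intro sum.cong) (auto simp: nn_integral_occupation borel vol)
    also have "ennreal a * \<dots> = ennreal (a * (?m * v))"
      using a0 vol(2) by (simp add: ennreal_mult ennreal_of_nat_eq_real_of_nat)
    finally show ?thesis .
  qed
  have "emeasure M ?E * ennreal (exp (- (\<theta> * (?m * K)))) \<le> ennreal (exp (- (lam * (a * (?m * v)))))"
    using u1 by (intro poisson_prod_le[OF poisson lam u_meas u0 _ S _ low]) (auto simp: a0 vol(2))
  then have "prob ?E * exp (- (\<theta> * (?m * K))) \<le> exp (- (lam * (a * (?m * v))))"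
    by (simp add: emeasure_eq_measure ennreal_mult[symmetric])
  then have "prob ?E \<le> exp (- (lam * (a * (?m * v)))) / exp (- (\<theta> * (?m * K)))"
    by (simp add: pos_le_divide_eq)
  also have "\<dots> = exp (\<theta> * (?m * K) - lam * (a * (?m * v)))"
    by (simp add: exp_diff[symmetric])
  also have "\<theta> * (?m * K) - lam * (a * (?m * v)) = - (lam * v * \<xi>\<^sup>2 / (2 * R) * card F)"
    using R(2) unfolding a_eq \<theta>_def K_def by (simp add: field_simps power2_eq_square)
  finally show ?thesis .
qed

end

subsection \<open>Cells and separated times\<close>

text \<open>\<open>B\<close> is enclosed between an open and a closed cube of the same
  volume.\<close>

lemma emeasure_lborel_half_open_cube:
  fixes a :: "real ^ 'd"
  assumes "l \<ge> 0" and sub: "box a (\<chi> j. a $ j + l) \<subseteq> B" "B \<subseteq> cbox a (\<chi> j. a $ j + l)"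
    and B: "B \<in> sets borel"
  shows "emeasure lborel B = ennreal (l ^ CARD('d))"
proof -
  let ?b = "\<chi> j. a $ j + l"
  have inner: "(?b - a) \<bullet> i = l" "a \<bullet> i \<le> ?b \<bullet> i" if "i \<in> Basis" for i
    using that \<open>l \<ge> 0\<close> by (auto simp: Basis_vec_def inner_axis)
  have "(\<Prod>i\<in>Basis. (?b - a) \<bullet> i) = (\<Prod>i\<in>(Basis :: (real^'d) set). l)"
    by (rule prod.cong) (auto simp: inner)
  also have "\<dots> = l ^ CARD('d)" by simp
  finally have "emeasure lborel (box a ?b) = ennreal (l ^ CARD('d))"
    "emeasure lborel (cbox a ?b) = ennreal (l ^ CARD('d))"
    using inner by (simp_all add: emeasure_lborel_box emeasure_lborel_cbox)
  then show ?thesis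
    using emeasure_mono[OF sub(1), of lborel] emeasure_mono[OF sub(2), of lborel] B
    by (intro antisym) auto
qed

lemma cell_borel: "cell L l (k :: 'd::finite \<Rightarrow> nat) \<in> sets borel"
proof -
  have "cell L l k = (\<Inter>j\<in>UNIV. {x. - L / 2 + real (k j) * l \<le> x $ j} \<inter> {x. x $ j < - L / 2 + (real (k j) + 1) * l})"
    by (auto simp: cell_def)
  also have "\<dots> \<in> sets borel"
    by (intro sets.finite_INT sets.Int borel_closed borel_open closed_Collect_le open_Collect_less continuous_intros) auto
  finally show ?thesis .
qed

lemma emeasure_cell:
  assumes "l \<ge> 0"
  shows "emeasure lborel (cell L l (k :: 'd::finite \<Rightarrow> nat)) = ennreal (l ^ CARD('d))"
proof (rule emeasure_lborel_half_open_cube[OF assms _ _ cell_borel])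
  let ?a = "\<chi> j. - L / 2 + real (k j) * l"
  show "box ?a (\<chi> j. ?a $ j + l) \<subseteq> cell L l k" "cell L l k \<subseteq> cbox ?a (\<chi> j. ?a $ j + l)"
    by (auto simp: cell_def mem_box_cart algebra_simps less_imp_le)
qed

lemma cells_finite_card:
  assumes "l > 0"
  shows "finite (cells (real n * l) l :: (real^'d::finite) set set)"
    and "card (cells (real n * l) l :: (real^'d) set set) \<le> n ^ CARD('d)"
proof -
  let ?K = "Pi\<^sub>E (UNIV :: 'd set) (\<lambda>_. {..<n})"
  have iff: "(real (k j) + 1) * l \<le> real n * l \<longleftrightarrow> k j < n" for k :: "'d \<Rightarrow> nat" and j
    using assms by (simp add: mult_le_cancel_right) linarith
  have eq: "(cells (real n * l) l :: (real^'d) set set) = cell (real n * l) l ` ?K"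
    unfolding cells_def iff by (auto simp: PiE_def)
  have "finite ?K" by (intro finite_PiE) auto
  then show "finite (cells (real n * l) l :: (real^'d) set set)" unfolding eq by simp
  have "card (cell (real n * l) l ` ?K) \<le> card ?K" by (rule card_image_le) fact
  also have "card ?K = n ^ CARD('d)" by (simp add: card_PiE)
  finally show "card (cells (real n * l) l :: (real^'d) set set) \<le> n ^ CARD('d)" unfolding eq .
qed

section \<open>Harmonic sums, residue classes and the number of choices\<close>

text \<open>The bound ln y \<le> y - 1 at y = n / (n + 1) gives 1 / (n + 1) \<le> ln (n + 1) - ln n,
  and these differences telescope.\<close>

lemma sum_inverse_le_ln:
  assumes "n > 0"
  shows "(\<Sum>k=1..n. 1 / real k) \<le> 1 + ln (real n)"
  using assms
proof (induction n rule: nat_induct_non_zero)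
  case (Suc n)
  have "ln (real n / real (Suc n)) \<le> real n / real (Suc n) - 1"
    using Suc by (intro ln_le_minus_one) simp
  then have "1 / real (Suc n) \<le> ln (real (Suc n)) - ln (real n)"
    using Suc by (simp add: ln_div field_simps)
  then show ?case using Suc by simp
qed simp

text \<open>If each of the g classes held fewer than x / g elements, \<open>T\<close> would have
  fewer than x.\<close>

lemma pigeonhole_residue_class:
  fixes T :: "nat set"
  assumes T: "finite T" "x \<le> real (card T)" and "g > 0"
  obtains S where "S \<subseteq> T" "card S = nat \<lceil>x / real g\<rceil>" "\<And>i j. i \<in> S \<Longrightarrow> j \<in> S \<Longrightarrow> i mod g = j mod g"
proof -
  let ?c = "\<lambda>r. {i\<in>T. i mod g = r}"
  have "\<exists>r<g. nat \<lceil>x / real g\<rceil> \<le> card (?c r)"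
  proof (rule ccontr)
    assume "\<not> ?thesis"
    \<comment> \<open>A natural number below the ceiling of x / g is below x / g itself.\<close>
    then have lt: "real (card (?c r)) < x / real g" if "r < g" for r
      using that by (auto simp: not_le less_ceiling_iff zless_nat_eq_int_zless)
    have "card T = (\<Sum>r<g. card (?c r))"
    proof -
      have "T = (\<Union>r\<in>{..<g}. ?c r)" using \<open>g > 0\<close> by auto
      also have "card \<dots> = (\<Sum>r<g. card (?c r))"
        by (rule card_UN_disjoint) (use T(1) in auto)
      finally show ?thesis .
    qed
    then have "real (card T) = (\<Sum>r<g. real (card (?c r)))" by simp
    also have "\<dots> < (\<Sum>r<g. x / real g)"
      by (rule sum_strict_mono) (use lt \<open>g > 0\<close> in auto)
    also have "\<dots> = x" using \<open>g > 0\<close> by simp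
    finally show False using T(2) by simp
  qed
  then obtain r where "nat \<lceil>x / real g\<rceil> \<le> card (?c r)" by blast
  then obtain S where "S \<subseteq> ?c r" "card S = nat \<lceil>x / real g\<rceil>"
    by (rule obtain_subset_with_card_n)
  then show thesis by (intro that[of S]) auto
qed

text \<open>A binomial coefficient times m! is a falling factorial with m factors, each at most
  \<open>card A\<close>.\<close>

lemma card_subsets_of_card_le:
  assumes "finite A"
  shows "card {F. F \<subseteq> A \<and> card F = m} \<le> card A ^ m"
proof -
  have "card {F. F \<subseteq> A \<and> card F = m} = card A choose m"
    by (rule n_subsets[OF assms])
  also have "\<dots> \<le> (card A choose m) * fact m" by simp
  also have "\<dots> \<le> card A ^ m" by (rule binomial_fact_pow)
  finally show ?thesis .
qed

text \<open>The gaps are distinct positive multiples of g with quotients at most t, so the sum is at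
  most v / g times a harmonic sum.\<close>

lemma sum_spaced_le:
  fixes F :: "(nat \<times> 'b) set"
  assumes F: "finite F" "inj_on fst F" "F \<subseteq> {..<t} \<times> A"
    and mod: "\<And>f h. f \<in> F \<Longrightarrow> h \<in> F \<Longrightarrow> fst f mod g = fst h mod g"
    and f: "f \<in> F" and "g > 0" "t > 0" "v \<ge> 0"
  shows "(\<Sum>h\<in>{h\<in>F. fst f < fst h}. v / real (fst h - fst f)) \<le> v / real g * (1 + ln (real t))"
proof -
  let ?H = "{h\<in>F. fst f < fst h}" and ?q = "\<lambda>h. (fst h - fst f) div g"
  have dv: "fst h - fst f = g * ?q h" if "h \<in> ?H" for h
    using mod[of h f] that f by (simp add: mod_eq_dvd_iff_nat)
  have "inj_on ?q ?H"
  proof (rule inj_onI)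
    fix h h' assume h: "h \<in> ?H" "h' \<in> ?H" "?q h = ?q h'"
    then have "fst h - fst f = fst h' - fst f" using dv by metis
    then have "fst h = fst h'" using h by auto
    then show "h = h'" using h F(2) by (auto dest: inj_onD)
  qed
  have "?q ` ?H \<subseteq> {1..t}"
  proof (intro image_subsetI)
    fix h assume h: "h \<in> ?H"
    then have "?q h \<noteq> 0" using dv[OF h] by (metis (mono_tags, lifting) mem_Collect_eq mult_0_right zero_less_diff less_irrefl)
    moreover have "?q h \<le> t" using h F(3) by (intro order_trans[OF div_le_dividend]) auto
    ultimately show "?q h \<in> {1..t}" by simp
  qed
  have "(\<Sum>h\<in>?H. v / real (fst h - fst f)) = (\<Sum>h\<in>?H. v / real g * (1 / real (?q h)))"
  proof (rule sum.cong)
    fix h assume "h \<in> ?H"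
    from dv[OF this] have "real (fst h - fst f) = real g * real (?q h)" by (metis of_nat_mult)
    then show "v / real (fst h - fst f) = v / real g * (1 / real (?q h))" by simp
  qed simp
  also have "\<dots> = (\<Sum>k\<in>?q ` ?H. v / real g * (1 / real k))"
    by (rule sum.reindex_cong[OF \<open>inj_on ?q ?H\<close> refl, symmetric]) simp
  also have "\<dots> \<le> (\<Sum>k=1..t. v / real g * (1 / real k))"
    by (rule sum_mono2) (use \<open>?q ` ?H \<subseteq> {1..t}\<close> \<open>v \<ge> 0\<close> in auto)
  also have "\<dots> \<le> v / real g * (1 + ln (real t))"
    unfolding sum_distrib_left[symmetric]
    using sum_inverse_le_ln[OF \<open>t > 0\<close>] \<open>v \<ge> 0\<close> by (intro mult_left_mono) auto
  finally show ?thesis .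
qed

subsection \<open>The union bound\<close>

context mobile_nodes
begin

lemma dense_event_sets:
  fixes l :: real
  assumes "l > 0"
  shows "dense_event M lam X \<zeta> \<xi> (real n * l) l i \<in> events"
  unfolding dense_event_def
proof (rule sets.sets_Collect_finite_All)
  show "finite (cells (real n * l) l :: (real^'d) set set)" by (rule cells_finite_card) fact
  fix B :: "(real^'d) set" assume "B \<in> cells (real n * l) l"
  then have [measurable]: "B \<in> sets borel" by (auto simp: cells_def cell_borel)
  show "{\<omega>\<in>space M. ennreal ((1 - \<xi>) * lam * l ^ CARD('d)) \<le> num_points (node_pos X \<zeta> (real i) \<omega>) B} \<in> events"
    by measurable
qed

text \<open>Each of the m chosen pairs costs a factor t^(d + 1) in the union bound: t times, and at
  most n^d \<le> t^d cells, where n \<le> t because l \<ge> 1.\<close>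

lemma prob_frequently_not_dense_le:
  fixes l \<xi> \<epsilon> :: real and t g n :: nat
  defines "m \<equiv> nat \<lceil>\<epsilon> * real t / real g\<rceil>"
  defines "R \<equiv> 1 + l\<^sup>2 / real g * (1 + ln (real t))"
  assumes d: "CARD('d) \<ge> 2" and lam: "lam \<ge> 0" and \<xi>: "0 < \<xi>" "\<xi> < 1"
    and t: "t > 0" "real t = real n * l" and l: "l \<ge> 1" and g: "g > 0"
  shows "prob {\<omega>\<in>space M. \<not> (1 - \<epsilon>) * real t \<le> (\<Sum>i<t. indicator (dense_event M lam X \<zeta> \<xi> (real t) l i) \<omega>)}
    \<le> (real t ^ (CARD('d) + 1) * exp (- (lam * l ^ CARD('d) * \<xi>\<^sup>2 / (2 * R)))) ^ m"
proof -
  let ?d = "CARD('d)" and ?D = "\<lambda>i. dense_event M lam X \<zeta> \<xi> (real t) l i"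
  let ?Bad = "{\<omega>\<in>space M. \<not> (1 - \<epsilon>) * real t \<le> (\<Sum>i<t. indicator (?D i) \<omega>)}"
  let ?C = "cells (real t) l :: (real^'d) set set"
  let ?low = "\<lambda>F. {\<omega>\<in>space M. \<forall>f\<in>F. num_points (node_pos X \<zeta> (real (fst f)) \<omega>) (snd f)
    < ennreal ((1 - \<xi>) * lam * l ^ ?d)}"
  \<comment> \<open>Distinct times in one residue class are at least g apart, which produces the
    division by g in \<open>R\<close>.\<close>
  define Fs where "Fs = {F. F \<subseteq> {..<t} \<times> ?C \<and> card F = m \<and> inj_on fst F \<and>
    (\<forall>f\<in>F. \<forall>h\<in>F. fst f mod g = fst h mod g)}"
  have l0: "l > 0" using l by simp
  have C: "finite ?C" "card ?C \<le> n ^ ?d"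
    using cells_finite_card[OF l0, of n, where 'd='d] t(2) by auto
  have C_cell: "\<exists>k. B = cell (real t) l k" if "B \<in> ?C" for B
    using that by (auto simp: cells_def)
  have "real n \<le> real t" using t(2) l by (simp add: mult_le_cancel_left1)
  then have "n ^ ?d \<le> t ^ ?d" by (intro power_mono) simp_all
  then have "card ?C \<le> t ^ ?d" using C(2) by linarith
  then have card_prod: "card ({..<t} \<times> ?C) \<le> t ^ (?d + 1)"
    by (simp add: card_cartesian_product mult_le_mono2)
  have fin_Fs: "finite Fs" and card_Fs: "card Fs \<le> (t ^ (?d + 1)) ^ m"
  proof -
    have sub: "Fs \<subseteq> {F. F \<subseteq> {..<t} \<times> ?C \<and> card F = m}" by (auto simp: Fs_def)
    have fin: "finite {F. F \<subseteq> {..<t} \<times> ?C \<and> card F = m}"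
      by (rule finite_subset[of _ "Pow ({..<t} \<times> ?C)"]) (use C in auto)
    show "finite Fs" by (rule finite_subset[OF sub fin])
    have "card Fs \<le> card ({..<t} \<times> ?C) ^ m"
      using card_mono[OF fin sub] card_subsets_of_card_le[of "{..<t} \<times> ?C" m] C(1) by simp
    also have "\<dots> \<le> (t ^ (?d + 1)) ^ m" by (rule power_mono[OF card_prod]) simp
    finally show "card Fs \<le> (t ^ (?d + 1)) ^ m" .
  qed
  have low: "?low F \<in> events \<and> prob (?low F) \<le> exp (- (lam * l ^ ?d * \<xi>\<^sup>2 / (2 * R))) ^ m" if "F \<in> Fs" for F
  proof
    have F: "finite F" "inj_on fst F" "F \<subseteq> {..<t} \<times> ?C" "card F = m"
      using that C(1) finite_subset[of F "{..<t} \<times> ?C"] by (simp_all add: Fs_def)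
    have mod: "fst f mod g = fst h mod g" if "f \<in> F" "h \<in> F" for f h
      using \<open>F \<in> Fs\<close> that unfolding Fs_def by blast
    have borel: "snd f \<in> sets borel" and vol: "emeasure lborel (snd f) = ennreal (l ^ ?d)" if "f \<in> F" for f
    proof -
      have "snd f \<in> ?C" using subsetD[OF F(3) that] by (simp add: mem_Times_iff)
      then obtain k where "snd f = cell (real t) l k" using C_cell by blast
      then show "snd f \<in> sets borel" "emeasure lborel (snd f) = ennreal (l ^ ?d)"
        using l by (simp_all add: cell_borel emeasure_cell)
    qed
    show "?low F \<in> events"
    proof (rule sets.sets_Collect_finite_All[OF _ F(1)])
      fix f assume "f \<in> F"
      note [measurable] = borel[OF this]
      show "{\<omega>\<in>space M. num_points (node_pos X \<zeta> (real (fst f)) \<omega>) (snd f) < ennreal ((1 - \<xi>) * lam * l ^ ?d)} \<in> events"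
        by measurable
    qed
    have "prob (?low F) \<le> exp (- (lam * l ^ ?d * \<xi>\<^sup>2 / (2 * R) * card F))"
    proof (rule prob_underpopulated_le[OF F(1,2) borel vol, where b="\<lambda>k. (l\<^sup>2 / (2 * pi)) / real k"])
      fix f i k y assume f: "f \<in> F" and i: "i < fst f"
      have "prob {\<omega>\<in>space M. y + (\<zeta> k (real (fst f)) \<omega> - \<zeta> k (real i) \<omega>) \<in> snd f}
          \<le> l\<^sup>2 / (2 * pi * (real (fst f) - real i))"
        using i l d by (intro brownian_increment_prob_le[OF brownian] borel f) (auto simp: vol f)
      then show "prob {\<omega>\<in>space M. y + (\<zeta> k (real (fst f)) \<omega> - \<zeta> k (real i) \<omega>) \<in> snd f}
          \<le> l\<^sup>2 / (2 * pi) / real (fst f - i)"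
        using i by (simp add: of_nat_diff)
    next
      fix f assume f: "f \<in> F"
      have "(\<Sum>h\<in>{h\<in>F. fst f < fst h}. (l\<^sup>2 / (2 * pi)) / real (fst h - fst f))
          \<le> (l\<^sup>2 / (2 * pi)) / real g * (1 + ln (real t))"
        by (rule sum_spaced_le[OF F(1-3) mod f g t(1)]) auto
      \<comment> \<open>The factor 1 / pi is dropped, so that twice the sum is at most
        \<open>R - 1\<close>.\<close>
      also have "\<dots> \<le> (l\<^sup>2 / 2) / real g * (1 + ln (real t))"
      proof (intro mult_right_mono divide_right_mono divide_left_mono)
        show "2 \<le> 2 * pi" using pi_gt3 by simp
      qed (use t in auto)
      finally show "1 + 2 * (\<Sum>h\<in>{h\<in>F. fst f < fst h}. (l\<^sup>2 / (2 * pi)) / real (fst h - fst f)) \<le> R"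
        unfolding R_def by simp
    qed (use l \<xi> lam t in \<open>auto simp: R_def\<close>)
    then show "prob (?low F) \<le> exp (- (lam * l ^ ?d * \<xi>\<^sup>2 / (2 * R))) ^ m"
      by (simp add: F(4) exp_of_nat_mult[symmetric] mult.commute)
  qed
  have "?Bad \<subseteq> (\<Union>F\<in>Fs. ?low F)"
  proof
    fix \<omega> assume \<omega>: "\<omega> \<in> ?Bad"
    define T where "T = {i. i < t \<and> \<omega> \<notin> ?D i}"
    \<comment> \<open>Good and bad times add up to t, so fewer than (1 - \<epsilon>) t good times
      leave at least \<epsilon> t bad ones.\<close>
    have "(\<Sum>i<t. indicator (?D i) \<omega>) + real (card T) = (\<Sum>i<t. indicator (?D i) \<omega> + (if \<omega> \<notin> ?D i then 1 else (0::real)))"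
      by (simp add: sum.distrib T_def sum.If_cases Int_def)
    also have "\<dots> = (\<Sum>i<t. 1)" by (intro sum.cong) auto
    finally have "\<epsilon> * real t \<le> real (card T)"
      using \<omega> by (simp add: algebra_simps)
    moreover have "finite T" by (simp add: T_def)
    ultimately obtain S where S: "S \<subseteq> T" "card S = m" "\<And>i j. i \<in> S \<Longrightarrow> j \<in> S \<Longrightarrow> i mod g = j mod g"
      using pigeonhole_residue_class[of T "\<epsilon> * real t" g] g unfolding m_def by blast
    have "\<exists>B\<in>?C. num_points (node_pos X \<zeta> (real i) \<omega>) B < ennreal ((1 - \<xi>) * lam * l ^ ?d)" if "i \<in> S" for i
      using that S(1) \<omega> by (auto simp: T_def dense_event_def not_le)
    then obtain B where B: "\<And>i. i \<in> S \<Longrightarrow> B i \<in> ?C"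
      "\<And>i. i \<in> S \<Longrightarrow> num_points (node_pos X \<zeta> (real i) \<omega>) (B i) < ennreal ((1 - \<xi>) * lam * l ^ ?d)"
      by metis
    have "(\<lambda>i. (i, B i)) ` S \<in> Fs"
      unfolding Fs_def
    proof (intro CollectI conjI ballI)
      show "(\<lambda>i. (i, B i)) ` S \<subseteq> {..<t} \<times> ?C" using S(1) B(1) by (auto simp: T_def)
      show "card ((\<lambda>i. (i, B i)) ` S) = m" using S(2) by (simp add: card_image inj_on_def)
      show "inj_on fst ((\<lambda>i. (i, B i)) ` S)" by (auto simp: inj_on_def)
      fix f h assume "f \<in> (\<lambda>i. (i, B i)) ` S" "h \<in> (\<lambda>i. (i, B i)) ` S"
      then show "fst f mod g = fst h mod g" using S(3)[of "fst f" "fst h"] by auto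
    qed
    moreover have "\<omega> \<in> ?low ((\<lambda>i. (i, B i)) ` S)" using B(2) \<omega> by auto
    ultimately show "\<omega> \<in> (\<Union>F\<in>Fs. ?low F)" by (rule UN_I)
  qed
  then have "prob ?Bad \<le> prob (\<Union>F\<in>Fs. ?low F)"
    using low fin_Fs by (intro finite_measure_mono sets.finite_UN) auto
  also have "\<dots> \<le> (\<Sum>F\<in>Fs. prob (?low F))"
    using low fin_Fs by (intro finite_measure_subadditive_finite) auto
  also have "\<dots> \<le> (\<Sum>F\<in>Fs. exp (- (lam * l ^ ?d * \<xi>\<^sup>2 / (2 * R))) ^ m)"
    by (rule sum_mono) (use low in blast)
  also have "\<dots> = real (card Fs) * exp (- (lam * l ^ ?d * \<xi>\<^sup>2 / (2 * R))) ^ m" by simp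
  also have "\<dots> \<le> (real t ^ (?d + 1)) ^ m * exp (- (lam * l ^ ?d * \<xi>\<^sup>2 / (2 * R))) ^ m"
  proof (rule mult_right_mono)
    show "real (card Fs) \<le> (real t ^ (?d + 1)) ^ m"
      using card_Fs by (metis of_nat_le_iff of_nat_power)
  qed simp
  finally show ?thesis by (simp add: power_mult_distrib)
qed

end

section \<open>Choice of the constants and conclusion\<close>

text \<open>Each of the two terms is at most half of l^d. The first: 2 K x \<le> x^2 \<le> x^3 \<le>
  l^d. The second: K x (1 + x) \<le> 2 K x^2 \<le> g / 2 and l^2 \<le> l^d, which explains why g is
  of order x^2.\<close>

lemma revisit_factor_bound:
  fixes l x K :: real
  assumes "K > 0" "x \<ge> 1" "x \<ge> 2 * K" "l \<ge> 1" "d \<ge> 2" and l: "l ^ d \<ge> x ^ 3"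
    and g: "g \<ge> 4 * K * x\<^sup>2"
  shows "K * x * (1 + l\<^sup>2 / g * (1 + x)) \<le> l ^ d"
proof -
  have g0: "g > 0" using g assms by (smt (verit) mult_pos_pos zero_less_power)
  have "2 * K * x \<le> x * x" using assms by (intro mult_right_mono) auto
  also have "\<dots> \<le> x ^ 3" using power_increasing[of 2 3 x] assms by (simp add: power2_eq_square)
  finally have 1: "K * x \<le> l ^ d / 2" using l by simp
  have "K * x * (1 + x) \<le> K * x * (2 * x)" using assms by (intro mult_left_mono) auto
  also have "\<dots> \<le> g / 2" using g by (simp add: power2_eq_square)
  finally have "l\<^sup>2 * (K * x * (1 + x)) \<le> l\<^sup>2 * (g / 2)" by (rule mult_left_mono) simp
  then have "l\<^sup>2 * (K * x * (1 + x)) / g \<le> l\<^sup>2 / 2" using g0 by (simp add: field_simps)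
  also have "\<dots> \<le> l ^ d / 2" using power_increasing[of 2 d l] assms by simp
  finally have "K * x * (l\<^sup>2 / g * (1 + x)) \<le> l ^ d / 2" by (simp add: mult_ac)
  moreover have "K * x * (1 + l\<^sup>2 / g * (1 + x)) = K * x + K * x * (l\<^sup>2 / g * (1 + x))"
    by (simp only: distrib_left mult_1_right)
  ultimately show ?thesis using 1 by linarith
qed

theorem proposition5p2:
  fixes lam \<xi> \<epsilon> :: real
  assumes "CARD('d::finite) \<ge> 2"
    and "lam > 0"
    and "0 < \<xi>" "\<xi> < 1"
    and "0 < \<epsilon>" "\<epsilon> < 1"
  shows "\<exists>C>0. \<exists>c>0. \<exists>t\<^sub>0::nat.
    \<forall>(M :: 'a measure) (X :: nat \<Rightarrow> 'a \<Rightarrow> real ^ 'd) \<zeta>. mobile_nodes M lam X \<zeta> \<longrightarrow>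
      (\<forall>t::nat. t > 0 \<longrightarrow> t \<ge> t\<^sub>0 \<longrightarrow>
        (\<forall>l::real. tessellates l (real t) \<longrightarrow> l ^ CARD('d) \<ge> C * ln (real t) ^ 3 \<longrightarrow>
          \<P>(\<omega> in M. (\<Sum>i<t. indicator (dense_event M lam X \<zeta> \<xi> (real t) l i) \<omega>) \<ge> (1 - \<epsilon>) * real t)
            \<ge> 1 - exp (- c * (lam * real t / ln (real t) powr (3 + 6 / real CARD('d))))))"
proof -
  let ?d = "CARD('d)"
  \<comment> \<open>Chosen so that lam \<xi>^2 K / 2 = d + 2: then K R ln t \<le> l^d makes the
    exponent of a single choice at least (d + 2) ln t per pair.\<close>
  define K where "K = 2 * (real ?d + 2) / (lam * \<xi>\<^sup>2)"
  \<comment> \<open>Comes from m \<ge> \<epsilon> t / g and g \<le> (4 K + 1) ln^2 t; dividing by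
    \<open>lam\<close> cancels the factor \<open>lam\<close> in the claim.\<close>
  define c where "c = \<epsilon> / (lam * (4 * K + 1))"
  \<comment> \<open>From t0 on, ln t \<ge> 1 + 2 K, which gives both ln t \<ge> 1 and ln t \<ge> 2
    K.\<close>
  define t0 where "t0 = nat \<lceil>exp (1 + 2 * K)\<rceil>"
  have K: "K > 0" using assms by (simp add: K_def)
  have c: "c > 0" using assms K by (simp add: c_def)
  have main: "\<P>(\<omega> in M. (\<Sum>i<t. indicator (dense_event M lam X \<zeta> \<xi> (real t) l i) \<omega>) \<ge> (1 - \<epsilon>) * real t)
      \<ge> 1 - exp (- c * (lam * real t / ln (real t) powr (3 + 6 / real ?d)))"
    if mn: "mobile_nodes M lam X \<zeta>" and t: "t > 0" "t \<ge> t0" and tess: "tessellates l (real t)"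
      and l: "l ^ ?d \<ge> ln (real t) ^ 3"
    for M :: "'a measure" and X :: "nat \<Rightarrow> 'a \<Rightarrow> real ^ 'd" and \<zeta> t l
  proof -
    interpret mobile_nodes M lam X \<zeta> by (rule mn)
    let ?x = "ln (real t)"
    obtain n where n: "real t = real n * l" and l0: "l > 0"
      using tess by (auto simp: tessellates_def)
    have "exp (1 + 2 * K) \<le> real t" using t(2) unfolding t0_def by linarith
    then have x: "?x \<ge> 1 + 2 * K" using t(1) by (simp add: ln_ge_iff)
    then have x1: "?x \<ge> 1" and x2: "?x \<ge> 2 * K" using K by auto
    have l1: "l \<ge> 1"
    proof (rule ccontr)
      assume "\<not> l \<ge> 1"
      then have "l ^ ?d < 1" using l0 by (intro power_less_one_iff[THEN iffD2]) auto
      moreover have "1 \<le> ?x ^ 3" using x1 by (rule one_le_power)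
      ultimately show False using l by simp
    qed
    \<comment> \<open>The least integer spacing that \<open>revisit_factor_bound\<close>
      admits.\<close>
    define g where "g = nat \<lceil>4 * K * ?x\<^sup>2\<rceil>"
    have "4 * K * ?x\<^sup>2 > 0" using K x1 by simp
    then have g: "g > 0" "real g \<ge> 4 * K * ?x\<^sup>2" "real g \<le> 4 * K * ?x\<^sup>2 + 1"
      unfolding g_def by linarith+
    define R where "R = 1 + l\<^sup>2 / real g * (1 + ?x)"
    define m where "m = nat \<lceil>\<epsilon> * real t / real g\<rceil>"
    define p where "p = \<P>(\<omega> in M. \<not> (1 - \<epsilon>) * real t \<le> (\<Sum>i<t. indicator (dense_event M lam X \<zeta> \<xi> (real t) l i) \<omega>))"
    have R: "R \<ge> 1" using x1 by (simp add: R_def)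
    have "K * ?x * R \<le> l ^ ?d"
      unfolding R_def by (rule revisit_factor_bound[OF K x1 x2 l1 assms(1) l g(2)])
    then have "(real ?d + 2) * ?x \<le> lam * l ^ ?d * \<xi>\<^sup>2 / (2 * R)"
      using R assms(2,3) by (simp add: K_def field_simps)
    then have "exp (- (lam * l ^ ?d * \<xi>\<^sup>2 / (2 * R))) \<le> exp (- ((real ?d + 2) * ?x))" by simp
    also have "\<dots> = 1 / real t ^ (?d + 2)"
    proof -
      have "(real ?d + 2) * ?x = real (?d + 2) * ?x" by simp
      then show ?thesis using t(1) by (simp only: exp_minus exp_of_nat_mult) (simp add: inverse_eq_divide)
    qed
    finally have "real t ^ (?d + 1) * exp (- (lam * l ^ ?d * \<xi>\<^sup>2 / (2 * R))) \<le> real t ^ (?d + 1) * (1 / real t ^ (?d + 2))"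
      by (rule mult_left_mono) simp
    \<comment> \<open>The exponent beats the number of choices with a factor 1 / t to spare, of
      which only exp (- 1) per chosen time is kept.\<close>
    also have "\<dots> = exp (- ?x)" using t(1) by (simp add: exp_minus field_simps)
    also have "\<dots> \<le> exp (- 1)" using x1 by simp
    finally have "(real t ^ (?d + 1) * exp (- (lam * l ^ ?d * \<xi>\<^sup>2 / (2 * R)))) ^ m \<le> exp (- 1) ^ m"
      by (rule power_mono) simp
    with prob_frequently_not_dense_le[OF assms(1) less_imp_le[OF assms(2)] assms(3,4) t(1) n l1 g(1), of \<epsilon>]
    have "p \<le> exp (- 1) ^ m"
      unfolding p_def R_def m_def by (rule order_trans)
    also have "\<dots> = exp (- real m)" by (simp add: exp_of_nat_mult[symmetric])
    also have "\<dots> \<le> exp (- c * (lam * real t / ?x powr (3 + 6 / real ?d)))"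
    proof -
      \<comment> \<open>Since ln t \<ge> 1, the denominator of order ln^2 t may be enlarged to the
        power 3 + 6/d of the claim.\<close>
      have "?x ^ 2 = ?x powr 2" using x1 by (simp add: powr_numeral)
      also have "\<dots> \<le> ?x powr (3 + 6 / real ?d)" using x1 by (intro powr_mono) auto
      finally have pw: "?x\<^sup>2 \<le> ?x powr (3 + 6 / real ?d)" .
      have "real g \<le> (4 * K + 1) * ?x\<^sup>2"
        using g(3) one_le_power[OF x1, of 2] by (simp add: algebra_simps)
      also have "\<dots> \<le> (4 * K + 1) * ?x powr (3 + 6 / real ?d)"
        using K by (intro mult_left_mono pw) auto
      finally have gle: "real g \<le> (4 * K + 1) * ?x powr (3 + 6 / real ?d)" .
      have "c * (lam * real t / ?x powr (3 + 6 / real ?d)) = \<epsilon> * real t / ((4 * K + 1) * ?x powr (3 + 6 / real ?d))"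
        using assms(2) by (simp add: c_def)
      also have "\<dots> \<le> \<epsilon> * real t / real g"
        using g(1) gle assms(5) by (intro divide_left_mono) auto
      also have "\<dots> \<le> real m" unfolding m_def by linarith
      finally show ?thesis by simp
    qed
    finally have p_le: "p \<le> exp (- c * (lam * real t / ?x powr (3 + 6 / real ?d)))" .
    have [measurable]: "dense_event M lam X \<zeta> \<xi> (real t) l i \<in> events" for i
      using dense_event_sets[OF l0] n by simp
    have "p = 1 - \<P>(\<omega> in M. (1 - \<epsilon>) * real t \<le> (\<Sum>i<t. indicator (dense_event M lam X \<zeta> \<xi> (real t) l i) \<omega>))"
      unfolding p_def by (rule prob_neg) measurable
    with p_le show ?thesis by simp
  qed
  show ?thesis
    \<comment> \<open>The witness C = 1 works because t0 absorbs the constant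
      \<open>K\<close>.\<close>
    by (rule exI[of _ 1], simp, rule exI[of _ c], simp add: c, rule exI[of _ t0]) (use main in auto)
qed

end
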